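(* Let $D, n_1,\ldots,n_D, m$ be positive integers, let $\mathcal{X}^\sharp \in \mathbb{R}^{n_1\times\cdots\times n_D}$ be a fixed tensor, and let $\mathcal{G}_1,\ldots,\mathcal{G}_m$ be independent random Gaussian tensors in $\mathbb{R}^{n_1\times\cdots\times n_D}$, each with independent $\mathcal{N}(0,1)$ entries. Set $y_i = \langle \mathcal{G}_i, \mathcal{X}^\sharp\rangle$ for $i=1,\ldots,m$. Let $\hat{\mathcal{X}}$ be a solution of the convex program $$\min_{\mathcal{X}\in\mathbb{R}^{n_1\times\cdots\times n_D}} \|\mathcal{X}\|_* \quad\text{subject to}\quad \langle \mathcal{G}_i,\mathcal{X}\rangle = y_i,\quad i=1,\ldots,m.$$ Then $$\mathbb{E}\,\big\|\hat{\mathcal{X}}-\mathcal{X}^\sharp\big\|_F \le 4\sqrt{\pi}\;\frac{\sqrt{n_1}+\cdots+\sqrt{n_D}}{\sqrt{m}}\;\|\mathcal{X}^\sharp\|_*.$$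
   Context: A tensor is an array $\mathcal{X}=(\mathcal{X}_{i_1,\ldots,i_D})\in\mathbb{R}^{n_1\times\cdots\times n_D}$ of real numbers. The scalar product is $\langle\mathcal{X},\mathcal{Y}\rangle=\sum_{i_1=1}^{n_1}\cdots\sum_{i_D=1}^{n_D}\mathcal{X}_{i_1,\ldots,i_D}\mathcal{Y}_{i_1,\ldots,i_D}$ and the Frobenius norm is $\|\mathcal{X}\|_F=\sqrt{\langle\mathcal{X},\mathcal{X}\rangle}$. For vectors $u^{(d)}\in\mathbb{R}^{n_d}$, $u^{(1)}\otimes\cdots\otimes u^{(D)}$ is the tensor with entries $\prod_{d=1}^D u^{(d)}_{i_d}$. The operator norm is $$\|\mathcal{X}\|=\max\{\langle\mathcal{X},u^{(1)}\otimes\cdots\otimes u^{(D)}\rangle : u^{(d)}\in\mathbb{R}^{n_d},\ \|u^{(d)}\|_2=1,\ d=1,\ldots,D\},$$ and the tensor nuclear norm is its dual norm $$\|\mathcal{X}\|_*=\max\{\langle\mathcal{X},\mathcal{Y}\rangle : \mathcal{Y}\in\mathbb{R}^{n_1\times\cdots\times n_D},\ \|\mathcal{Y}\|\le 1\}.$$ *)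

theory Defs
  imports "HOL-Probability.Probability"
begin

text \<open>
  The dimensions are given by \<^term>\<open>n :: nat \<Rightarrow> nat\<close>, of which only the values at \<open>1, \<dots>, D\<close> matter.
  A multi-index is an extensional function, and so is a tensor; hence tensors form the space of
  the product measure of copies of the reals over the multi-indices.
\<close>

definition tensor_index :: "nat \<Rightarrow> (nat \<Rightarrow> nat) \<Rightarrow> (nat \<Rightarrow> nat) set" where
  "tensor_index D n = (\<Pi>\<^sub>E d\<in>{1..D}. {1..n d})"

definition tensors :: "nat \<Rightarrow> (nat \<Rightarrow> nat) \<Rightarrow> ((nat \<Rightarrow> nat) \<Rightarrow> real) set" where
  "tensors D n = (\<Pi>\<^sub>E k\<in>tensor_index D n. UNIV)"

definition tensor_inner ::
  "nat \<Rightarrow> (nat \<Rightarrow> nat) \<Rightarrow> ((nat \<Rightarrow> nat) \<Rightarrow> real) \<Rightarrow> ((nat \<Rightarrow> nat) \<Rightarrow> real) \<Rightarrow> real" where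
  "tensor_inner D n X Y = (\<Sum>k\<in>tensor_index D n. X k * Y k)"

definition frobenius_norm :: "nat \<Rightarrow> (nat \<Rightarrow> nat) \<Rightarrow> ((nat \<Rightarrow> nat) \<Rightarrow> real) \<Rightarrow> real" where
  "frobenius_norm D n X = sqrt (tensor_inner D n X X)"

definition tensor_diff ::
  "nat \<Rightarrow> (nat \<Rightarrow> nat) \<Rightarrow> ((nat \<Rightarrow> nat) \<Rightarrow> real) \<Rightarrow> ((nat \<Rightarrow> nat) \<Rightarrow> real) \<Rightarrow> (nat \<Rightarrow> nat) \<Rightarrow> real" where
  "tensor_diff D n X Y = (\<lambda>k\<in>tensor_index D n. X k - Y k)"

definition rank_one :: "nat \<Rightarrow> (nat \<Rightarrow> nat) \<Rightarrow> (nat \<Rightarrow> nat \<Rightarrow> real) \<Rightarrow> (nat \<Rightarrow> nat) \<Rightarrow> real" where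
  "rank_one D n u = (\<lambda>k\<in>tensor_index D n. \<Prod>d=1..D. u d (k d))"

text \<open>
  The two norms are maxima, attained by compactness, so they are written as suprema of bounded
  nonempty sets of reals (for positive dimensions). The vector \<open>u d\<close> has the entries
  \<open>u d 1, \<dots>, u d (n d)\<close>; its other values are irrelevant.
\<close>

definition operator_norm :: "nat \<Rightarrow> (nat \<Rightarrow> nat) \<Rightarrow> ((nat \<Rightarrow> nat) \<Rightarrow> real) \<Rightarrow> real" where
  "operator_norm D n X =
     Sup {tensor_inner D n X (rank_one D n u) | u. \<forall>d\<in>{1..D}. L2_set (u d) {1..n d} = 1}"

definition nuclear_norm :: "nat \<Rightarrow> (nat \<Rightarrow> nat) \<Rightarrow> ((nat \<Rightarrow> nat) \<Rightarrow> real) \<Rightarrow> real" where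
  "nuclear_norm D n X =
     Sup {tensor_inner D n X Y | Y. Y \<in> tensors D n \<and> operator_norm D n Y \<le> 1}"

definition standard_gaussian_tensor ::
  "nat \<Rightarrow> (nat \<Rightarrow> nat) \<Rightarrow> 'a measure \<Rightarrow> ('a \<Rightarrow> (nat \<Rightarrow> nat) \<Rightarrow> real) \<Rightarrow> bool" where
  "standard_gaussian_tensor D n M G \<longleftrightarrow>
     G \<in> measurable M (PiM (tensor_index D n) (\<lambda>_. borel)) \<and>
     prob_space.indep_vars M (\<lambda>_. borel) (\<lambda>k \<omega>. G \<omega> k) (tensor_index D n) \<and>
     (\<forall>k\<in>tensor_index D n. distributed M lborel (\<lambda>\<omega>. G \<omega> k) (\<lambda>x. ennreal (std_normal_density x)))"

definition is_nuclear_solution ::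
  "nat \<Rightarrow> (nat \<Rightarrow> nat) \<Rightarrow> nat \<Rightarrow> (nat \<Rightarrow> (nat \<Rightarrow> nat) \<Rightarrow> real) \<Rightarrow> (nat \<Rightarrow> real)
     \<Rightarrow> ((nat \<Rightarrow> nat) \<Rightarrow> real) \<Rightarrow> bool" where
  "is_nuclear_solution D n m A y =
     is_arg_min (nuclear_norm D n)
       (\<lambda>X. X \<in> tensors D n \<and> (\<forall>i\<in>{1..m}. tensor_inner D n (A i) X = y i))"

end

theory Submission
  imports Defs
begin

text \<open>
  The error \<open>h\<close> of a solution lies in the kernel of the measurements and has nuclear norm at most
  \<open>2 \<parallel>X\<parallel>\<^sub>*\<close>. Since \<open>E \<bar>\<langle>G, u\<rangle>\<bar> = sqrt (2 / pi) \<parallel>u\<parallel>\<close>, the quantity \<open>m sqrt (2 / pi) \<parallel>h\<parallel>\<close> is at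
  most the supremum over such \<open>u\<close> of \<open>\<Sum>i. E \<bar>\<langle>G\<^sub>i, u\<rangle>\<bar> - \<bar>\<langle>G\<^sub>i, u\<rangle>\<bar>\<close>. Symmetrization and the one-sided
  contraction principle, applied to one \<open>i\<close> at a time, bound the expectation of this supremum by that of
  \<open>2 \<langle>\<Sum>i. G\<^sub>i, u\<rangle>\<close>, hence by \<open>4 \<parallel>X\<parallel>\<^sub>* E \<parallel>\<Sum>i. G\<^sub>i\<parallel>\<close>. The expected operator norm of the Gaussian
  tensor is at most \<open>sqrt (2 m) (\<Sum>d. sqrt n\<^sub>d)\<close> by a PAC-Bayes argument: smoothing the unit vectors
  \<open>u\<^sub>d\<close> by Gaussian noise preserves the mean of the multilinear form, and the Gibbs variational
  principle bounds all these means at once by a single exponential moment plus a relative entropy.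
\<close>

section \<open>Symmetrization and contraction for finite maxima\<close>

text \<open>Fubini with the new coordinate as the outer variable. The induction over the
  measurements fixes that coordinate and applies its hypothesis to the inner integral over
  \<open>I\<close>.\<close>

lemma (in product_sigma_finite) product_integral_insert_rev:
  fixes f :: "_ \<Rightarrow> real"
  assumes "finite I" "i \<notin> I" and f: "integrable (Pi\<^sub>M (insert i I) M) f"
  shows "integral\<^sup>L (Pi\<^sub>M (insert i I) M) f = (\<integral>y. (\<integral>x. f (x(i := y)) \<partial>Pi\<^sub>M I M) \<partial>M i)"
proof -
  interpret I: finite_product_sigma_finite M I by standard fact
  interpret P: pair_sigma_finite "M i" "Pi\<^sub>M I M" ..
  note f' = f[THEN borel_measurable_integrable]
  have meas: "(\<lambda>(y, x). x(i := y)) \<in> measurable (M i \<Otimes>\<^sub>M Pi\<^sub>M I M) (Pi\<^sub>M (insert i I) M)"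
    unfolding case_prod_beta by (rule measurable_fun_upd[where J = I]) auto
  have "integrable (M i \<Otimes>\<^sub>M Pi\<^sub>M I M) (\<lambda>(y, x). f (x(i := y)))"
  proof (rule integrableI_bounded)
    show "(\<lambda>(y, x). f (x(i := y))) \<in> borel_measurable (M i \<Otimes>\<^sub>M Pi\<^sub>M I M)"
      using measurable_compose[OF meas f'] by (simp add: case_prod_beta)
    have "(\<integral>\<^sup>+z. norm (case z of (y, x) \<Rightarrow> f (x(i := y))) \<partial>(M i \<Otimes>\<^sub>M Pi\<^sub>M I M))
        = (\<integral>\<^sup>+y. (\<integral>\<^sup>+x. norm (f (x(i := y))) \<partial>Pi\<^sub>M I M) \<partial>M i)"
      using measurable_compose[OF meas f']
      by (subst I.nn_integral_fst[symmetric]) (simp_all add: case_prod_beta)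
    also have "\<dots> = (\<integral>\<^sup>+x. norm (f x) \<partial>Pi\<^sub>M (insert i I) M)"
      using f' assms by (intro product_nn_integral_insert_rev[symmetric]) auto
    also have "\<dots> < \<infinity>"
      using f by (simp add: integrable_iff_bounded)
    finally show "(\<integral>\<^sup>+z. norm (case z of (y, x) \<Rightarrow> f (x(i := y))) \<partial>(M i \<Otimes>\<^sub>M Pi\<^sub>M I M)) < \<infinity>" .
  qed
  from P.Fubini_integral[OF this] show ?thesis
    using product_integral_insert[OF assms] by simp
qed

lemma integrable_MAX:
  fixes f :: "'b \<Rightarrow> 'a \<Rightarrow> real"
  assumes "finite F" "F \<noteq> {}" "\<And>u. u \<in> F \<Longrightarrow> integrable M (f u)"
  shows "integrable M (\<lambda>x. MAX u\<in>F. f u x)"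
  using assms
proof (induction F rule: finite_ne_induct)
  case (insert u F)
  have "(\<lambda>x. MAX v\<in>insert u F. f v x) = (\<lambda>x. max (f u x) (MAX v\<in>F. f v x))"
    using insert.hyps by (simp add: fun_eq_iff)
  then show ?case using insert by simp
qed simp

text \<open>If \<open>u\<close> and \<open>v\<close> are the maximisers on the left, then \<open>\<bar>a u\<bar> - \<bar>a v\<bar> \<le> \<bar>a u - a v\<bar>\<close>, and on the right
  \<open>u\<close> and \<open>v\<close> may be used in either order.\<close>

lemma MAX_abs_contraction:
  fixes c a :: "'b \<Rightarrow> real"
  assumes "finite F" "F \<noteq> {}"
  shows "(MAX u\<in>F. c u + \<bar>a u\<bar>) + (MAX u\<in>F. c u - \<bar>a u\<bar>) \<le> (MAX u\<in>F. c u + a u) + (MAX u\<in>F. c u - a u)"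
proof -
  obtain u where u: "u \<in> F" "(MAX u\<in>F. c u + \<bar>a u\<bar>) = c u + \<bar>a u\<bar>"
    using imageE[OF Max_in[of "(\<lambda>u. c u + \<bar>a u\<bar>) ` F"]] assms by blast
  obtain v where v: "v \<in> F" "(MAX u\<in>F. c u - \<bar>a u\<bar>) = c v - \<bar>a v\<bar>"
    using imageE[OF Max_in[of "(\<lambda>u. c u - \<bar>a u\<bar>) ` F"]] assms by blast
  have "c u + a u \<le> (MAX u\<in>F. c u + a u)" "c v + a v \<le> (MAX u\<in>F. c u + a u)"
    "c u - a u \<le> (MAX u\<in>F. c u - a u)" "c v - a v \<le> (MAX u\<in>F. c u - a u)"
    using u v assms by (auto intro!: Max_ge)
  then show ?thesis unfolding u v by linarith
qed

text \<open>The maximand on the left is the average of \<open>c u\<close> plus twice the mean of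
  \<open>\<bar>a u x\<bar>\<close> and of \<open>c u - 2 * \<bar>a u x\<bar>\<close>. The maximum of
  the first is at most an expectation of a maximum, \<open>MAX_abs_contraction\<close> removes both
  absolute values at the same \<open>x\<close>, and \<open>sym\<close> identifies the two remaining
  expectations. This takes the place of random signs and an independent copy.\<close>

lemma (in prob_space) expectation_MAX_symmetrization:
  fixes a :: "'b \<Rightarrow> 'a \<Rightarrow> real" and c :: "'b \<Rightarrow> real"
  assumes F: "finite F" "F \<noteq> {}" and a: "\<And>u. u \<in> F \<Longrightarrow> integrable M (a u)"
    and sym: "expectation (\<lambda>x. MAX u\<in>F. c u - 2 * a u x) = expectation (\<lambda>x. MAX u\<in>F. c u + 2 * a u x)"
  shows "expectation (\<lambda>x. MAX u\<in>F. c u + (expectation (\<lambda>x. \<bar>a u x\<bar>) - \<bar>a u x\<bar>))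
      \<le> expectation (\<lambda>x. MAX u\<in>F. c u + 2 * a u x)"
proof -
  have int: "integrable M (\<lambda>x. MAX u\<in>F. c u + 2 * \<bar>a u x\<bar>)" "integrable M (\<lambda>x. MAX u\<in>F. c u - 2 * \<bar>a u x\<bar>)"
    "integrable M (\<lambda>x. MAX u\<in>F. c u + 2 * a u x)" "integrable M (\<lambda>x. MAX u\<in>F. c u - 2 * a u x)"
    "integrable M (\<lambda>x. MAX u\<in>F. c u + (expectation (\<lambda>x. \<bar>a u x\<bar>) - \<bar>a u x\<bar>))"
    using a by (auto intro!: integrable_MAX F)
  let ?E = "expectation (\<lambda>x. MAX u\<in>F. c u + 2 * \<bar>a u x\<bar>)"
  have le: "c u + 2 * expectation (\<lambda>x. \<bar>a u x\<bar>) \<le> ?E" if u: "u \<in> F" for u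
  proof -
    have "c u + 2 * expectation (\<lambda>x. \<bar>a u x\<bar>) = expectation (\<lambda>x. c u + 2 * \<bar>a u x\<bar>)"
      using a[OF u] by (simp add: prob_space)
    also have "\<dots> \<le> ?E"
      using a[OF u] int u F by (intro integral_mono) (auto intro!: Max_ge)
    finally show ?thesis .
  qed
  have "expectation (\<lambda>x. MAX u\<in>F. c u + (expectation (\<lambda>x. \<bar>a u x\<bar>) - \<bar>a u x\<bar>))
      \<le> expectation (\<lambda>x. (?E + (MAX u\<in>F. c u - 2 * \<bar>a u x\<bar>)) / 2)"
  proof (rule integral_mono)
    fix x
    show "(MAX u\<in>F. c u + (expectation (\<lambda>x. \<bar>a u x\<bar>) - \<bar>a u x\<bar>)) \<le> (?E + (MAX u\<in>F. c u - 2 * \<bar>a u x\<bar>)) / 2"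
    proof (rule Max.boundedI)
      fix z assume "z \<in> (\<lambda>u. c u + (expectation (\<lambda>x. \<bar>a u x\<bar>) - \<bar>a u x\<bar>)) ` F"
      then obtain u where u: "u \<in> F" "z = c u + (expectation (\<lambda>x. \<bar>a u x\<bar>) - \<bar>a u x\<bar>)" by auto
      have "c u - 2 * \<bar>a u x\<bar> \<le> (MAX u\<in>F. c u - 2 * \<bar>a u x\<bar>)"
        using u F by (intro Max_ge) auto
      with le[OF u(1)] show "z \<le> (?E + (MAX u\<in>F. c u - 2 * \<bar>a u x\<bar>)) / 2"
        unfolding u(2) by argo
    qed (use F in auto)
  qed (use int in \<open>auto intro!: integrable_divide\<close>)
  also have "\<dots> = (?E + expectation (\<lambda>x. MAX u\<in>F. c u - 2 * \<bar>a u x\<bar>)) / 2"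
    using int by (simp add: prob_space)
  also have "\<dots> = expectation (\<lambda>x. (MAX u\<in>F. c u + 2 * \<bar>a u x\<bar>) + (MAX u\<in>F. c u - 2 * \<bar>a u x\<bar>)) / 2"
    using int by simp
  also have "\<dots> \<le> expectation (\<lambda>x. (MAX u\<in>F. c u + 2 * a u x) + (MAX u\<in>F. c u - 2 * a u x)) / 2"
    using MAX_abs_contraction[OF F, of c "\<lambda>u. 2 * a u _"] int
    by (intro divide_right_mono integral_mono) (auto simp: abs_mult)
  also have "\<dots> = expectation (\<lambda>x. MAX u\<in>F. c u + 2 * a u x)"
    using int sym by simp
  finally show ?thesis .
qed

lemma integrable_PiM_component:
  fixes f :: "'a \<Rightarrow> real"
  assumes "\<And>i. i \<in> I \<Longrightarrow> prob_space (M i)" "i \<in> I" "integrable (M i) f"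
  shows "integrable (PiM I M) (\<lambda>x. f (x i))"
proof -
  have "integrable (distr (PiM I M) (M i) (\<lambda>\<omega>. \<omega> i)) f"
    using assms by (subst distr_PiM_component) auto
  then show ?thesis
    using assms by (subst (asm) integrable_distr_eq) (auto dest: borel_measurable_integrable)
qed

lemma (in prob_space) expectation_MAX_symmetrization_PiM:
  fixes a :: "'b \<Rightarrow> 'a \<Rightarrow> real" and c :: "'b \<Rightarrow> real"
  assumes F: "finite F" "F \<noteq> {}" and a: "\<And>u. u \<in> F \<Longrightarrow> integrable M (a u)"
    and sym: "\<And>c. expectation (\<lambda>x. MAX u\<in>F. c u - 2 * a u x) = expectation (\<lambda>x. MAX u\<in>F. c u + 2 * a u x)"
    and I: "finite I"
  shows "(\<integral>x. (MAX u\<in>F. c u + (\<Sum>i\<in>I. expectation (\<lambda>x. \<bar>a u x\<bar>) - \<bar>a u (x i)\<bar>)) \<partial>Pi\<^sub>M I (\<lambda>_. M))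
      \<le> (\<integral>x. (MAX u\<in>F. c u + (\<Sum>i\<in>I. 2 * a u (x i))) \<partial>Pi\<^sub>M I (\<lambda>_. M))"
  using I
proof (induction I arbitrary: c)
  case (insert i I)
  let ?e = "\<lambda>u. expectation (\<lambda>x. \<bar>a u x\<bar>)"
  let ?M = "Pi\<^sub>M (insert i I) (\<lambda>_. M)"
  note ps = prob_space_axioms
  interpret Q: product_prob_space "\<lambda>_::'c. M" by standard
  have comp: "integrable (Pi\<^sub>M J (\<lambda>_. M)) (\<lambda>x. a u (x j))" if "u \<in> F" "j \<in> J" for u and j :: 'c and J
    by (rule integrable_PiM_component) (use that a ps in auto)
  have int1: "integrable (Pi\<^sub>M J (\<lambda>_. M)) (\<lambda>x. MAX u\<in>F. c u + (\<Sum>i\<in>J. ?e u - \<bar>a u (x i)\<bar>))"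
    for J :: "'c set" and c
    using comp prob_space_PiM[of J "\<lambda>_. M"] ps
    by (intro integrable_MAX F Bochner_Integration.integrable_add Bochner_Integration.integrable_sum
        Bochner_Integration.integrable_diff integrable_abs) (auto intro: prob_space.finite_measure finite_measure.integrable_const)
  have int2: "integrable (Pi\<^sub>M J (\<lambda>_. M)) (\<lambda>x. MAX u\<in>F. c u + (\<Sum>i\<in>J. 2 * a u (x i)))"
    for J :: "'c set" and c
    using comp prob_space_PiM[of J "\<lambda>_. M"] ps
    by (intro integrable_MAX F Bochner_Integration.integrable_add Bochner_Integration.integrable_sum
        Bochner_Integration.integrable_mult_right) (auto intro: prob_space.finite_measure finite_measure.integrable_const)
  let ?f = "\<lambda>x. MAX u\<in>F. c u + (\<Sum>i\<in>insert i I. ?e u - \<bar>a u (x i)\<bar>)"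
  let ?h = "\<lambda>x. MAX u\<in>F. c u + (\<Sum>i\<in>insert i I. 2 * a u (x i))"
  \<comment> \<open>The hybrid between \<open>?f\<close> and \<open>?h\<close>: linear at the new
    coordinate \<open>i\<close>, still with absolute values on \<open>I\<close>.\<close>
  let ?g = "\<lambda>x. MAX u\<in>F. c u + 2 * a u (x i) + (\<Sum>j\<in>I. ?e u - \<bar>a u (x j)\<bar>)"
  have int3: "integrable ?M ?g"
    using comp prob_space_PiM[of "insert i I" "\<lambda>_. M"] ps
    by (intro integrable_MAX F Bochner_Integration.integrable_add Bochner_Integration.integrable_sum
        Bochner_Integration.integrable_diff integrable_abs Bochner_Integration.integrable_mult_right)
      (auto intro: prob_space.finite_measure finite_measure.integrable_const)
  have f: "integrable ?M ?f" and h: "integrable ?M ?h"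
    by (rule int1 int2)+
  have upd: "(\<Sum>j\<in>I. ?e u - \<bar>a u (if j = i then y else x j)\<bar>) = (\<Sum>j\<in>I. ?e u - \<bar>a u (x j)\<bar>)"
    "(\<Sum>j\<in>I. 2 * a u (if j = i then y else x j)) = (\<Sum>j\<in>I. 2 * a u (x j))" for u x y
    using insert.hyps by (auto intro!: sum.cong)
  \<comment> \<open>The coordinates in \<open>I\<close> are frozen and the one-coordinate lemma is
    applied in \<open>i\<close>. Integrating the difference reduces the claim to the sign of the
    inner integral; the iterated integrals need no integrability in the outer variable.\<close>
  have "0 \<le> (\<integral>x. ?g x - ?f x \<partial>?M)"
  proof (subst Q.product_integral_insert[OF insert.hyps Bochner_Integration.integrable_diff[OF int3 f]],
      rule Bochner_Integration.integral_nonneg)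
    fix x
    define d where "d u = c u + (\<Sum>j\<in>I. ?e u - \<bar>a u (x j)\<bar>)" for u
    have "expectation (\<lambda>y. MAX u\<in>F. d u + (?e u - \<bar>a u y\<bar>)) \<le> expectation (\<lambda>y. MAX u\<in>F. d u + 2 * a u y)"
      by (rule expectation_MAX_symmetrization[OF F a sym])
    moreover have "integrable M (\<lambda>y. MAX u\<in>F. d u + (?e u - \<bar>a u y\<bar>))" "integrable M (\<lambda>y. MAX u\<in>F. d u + 2 * a u y)"
      using a by (auto intro!: integrable_MAX F)
    moreover have "?f (x(i := y)) = (MAX u\<in>F. d u + (?e u - \<bar>a u y\<bar>))"
      "?g (x(i := y)) = (MAX u\<in>F. d u + 2 * a u y)" for y
      using insert.hyps unfolding d_def by (simp_all add: upd add_ac)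
    ultimately show "0 \<le> (\<integral>y. ?g (x(i := y)) - ?f (x(i := y)) \<partial>M)"
      by simp
  qed
  \<comment> \<open>Now coordinate \<open>i\<close> is frozen and its linear term joins
    \<open>c\<close>; the induction hypothesis treats the inner integral over
    \<open>I\<close>.\<close>
  moreover have "0 \<le> (\<integral>x. ?h x - ?g x \<partial>?M)"
  proof (subst Q.product_integral_insert_rev[OF insert.hyps Bochner_Integration.integrable_diff[OF h int3]],
      rule Bochner_Integration.integral_nonneg)
    fix y
    define d where "d u = c u + 2 * a u y" for u
    have "?h (x(i := y)) = (MAX u\<in>F. d u + (\<Sum>j\<in>I. 2 * a u (x j)))"
      "?g (x(i := y)) = (MAX u\<in>F. d u + (\<Sum>j\<in>I. ?e u - \<bar>a u (x j)\<bar>))" for x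
      using insert.hyps unfolding d_def by (simp_all add: upd add_ac)
    then show "0 \<le> (\<integral>x. ?h (x(i := y)) - ?g (x(i := y)) \<partial>Pi\<^sub>M I (\<lambda>_. M))"
      using insert.IH[of d] int1[of I d] int2[of I d] by simp
  qed
  ultimately show ?case
    using f h int3 by simp
qed simp

section \<open>Standard Gaussian vectors\<close>

definition std_gauss :: "'i set \<Rightarrow> ('i \<Rightarrow> real) measure" where
  "std_gauss K = Pi\<^sub>M K (\<lambda>_. density lborel std_normal_density)"

interpretation std_normal: prob_space "density lborel (\<lambda>x. ennreal (std_normal_density x))"
  by (rule prob_space_normal_density) simp

lemma prob_space_std_gauss: "prob_space (std_gauss K)"
  unfolding std_gauss_def by (rule prob_space_PiM) (rule std_normal.prob_space_axioms)

lemma measurable_std_gauss_component: "k \<in> K \<Longrightarrow> (\<lambda>g. g k) \<in> borel_measurable (std_gauss K)"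
  unfolding std_gauss_def by measurable

lemma distributed_std_gauss_component:
  assumes "k \<in> K"
  shows "distributed (std_gauss K) lborel (\<lambda>g. g k) std_normal_density"
proof -
  have "distr (std_gauss K) lborel (\<lambda>g. g k) = distr (std_gauss K) (density lborel std_normal_density) (\<lambda>g. g k)"
    by (rule distr_cong) auto
  also have "\<dots> = density lborel std_normal_density"
    unfolding std_gauss_def using assms std_normal.prob_space_axioms by (intro distr_PiM_component)
  finally show ?thesis
    using measurable_std_gauss_component[OF assms] by (simp add: distributed_def)
qed

text \<open>The coordinate map is the identity on extensional points and every marginal is standard
  normal, so the joint law is the product of the marginals. This criterion asks for a nonempty index
  set, hence the case split.\<close>

lemma indep_vars_std_gauss:
  assumes "finite K"
  shows "prob_space.indep_vars (std_gauss K) (\<lambda>_. borel) (\<lambda>k g. g k) K"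
proof (cases "K = {}")
  case True
  then show ?thesis
    by (simp add: prob_space.indep_vars_def2[OF prob_space_std_gauss] prob_space.indep_sets_def[OF prob_space_std_gauss])
next
  case False
  interpret prob_space "std_gauss K" by (rule prob_space_std_gauss)
  let ?N = "density lborel (\<lambda>x. ennreal (std_normal_density x))"
  have "distr (std_gauss K) borel (\<lambda>g. g k) = ?N" if "k \<in> K" for k
    using distributed_distr_eq_density[OF distributed_std_gauss_component[OF that]]
    by (metis distr_cong sets_lborel)
  then have "Pi\<^sub>M K (\<lambda>k. distr (std_gauss K) borel (\<lambda>g. g k)) = std_gauss K"
    unfolding std_gauss_def by (intro PiM_cong) (auto simp: std_gauss_def)
  moreover have "distr (std_gauss K) (\<Pi>\<^sub>M k\<in>K. borel) (\<lambda>g. \<lambda>k\<in>K. g k) = distr (std_gauss K) (std_gauss K) (\<lambda>g. g)"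
    by (intro distr_cong) (auto simp: std_gauss_def space_PiM extensional_restrict PiE_def intro!: sets_PiM_cong)
  ultimately show ?thesis
    by (subst indep_vars_iff_distr_eq_PiM') (auto simp: False distr_id measurable_std_gauss_component)
qed

text \<open>The symmetry of the law, from which the hypothesis \<open>sym\<close> of the
  symmetrization lemmas is obtained.\<close>

lemma integral_std_gauss_uminus:
  fixes f :: "('i \<Rightarrow> real) \<Rightarrow> real"
  assumes K: "finite K" and f: "f \<in> borel_measurable (std_gauss K)"
  shows "(\<integral>g. f (\<lambda>k\<in>K. - g k) \<partial>std_gauss K) = (\<integral>g. f g \<partial>std_gauss K)"
proof -
  let ?N = "density lborel (\<lambda>x. ennreal (std_normal_density x))"
  have "distributed ?N lborel (\<lambda>x. 0 + (-1) * x) (normal_density (0 + (-1) * 0) (\<bar>-1\<bar> * 1))"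
    by (rule std_normal.normal_density_affine) (auto simp: distributed_def intro: distr_id2)
  then have "distr ?N lborel uminus = ?N"
    by (simp add: distributed_def)
  moreover have "distr ?N ?N uminus = distr ?N lborel uminus"
    by (rule distr_cong) auto
  ultimately have "distr ?N ?N uminus = ?N"
    by simp
  then have "distr (std_gauss K) (std_gauss K) (compose K uminus) = std_gauss K"
    unfolding std_gauss_def
    by (subst distr_PiM_finite_prob_space'[OF K]) (auto intro: std_normal.prob_space_axioms)
  moreover have "compose K uminus \<in> measurable (std_gauss K) (std_gauss K)"
    unfolding std_gauss_def compose_def by measurable
  ultimately have "(\<integral>g. f g \<partial>std_gauss K) = (\<integral>g. f (compose K uminus g) \<partial>std_gauss K)"
    using f integral_distr by metis
  then show ?thesis by (simp add: compose_def)
qed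

lemma integrable_std_gauss_component:
  assumes "k \<in> K"
  shows "integrable (std_gauss K) (\<lambda>g. g k)"
proof -
  have "integrable lborel (\<lambda>x. std_normal_density x * x)"
    using integrable_std_normal_moment[of 1] by simp
  then have "integrable (density lborel std_normal_density) (\<lambda>x::real. x)"
    by (subst integrable_density) auto
  then show ?thesis
    unfolding std_gauss_def using assms std_normal.prob_space_axioms by (intro integrable_PiM_component)
qed

text \<open>The linear combination is a centred normal variable with standard deviation
  \<open>L2_set u K\<close>.\<close>

lemma integral_abs_std_gauss_linear:
  assumes K: "finite K"
  shows "(\<integral>g. \<bar>\<Sum>k\<in>K. u k * g k\<bar> \<partial>std_gauss K) = sqrt (2 / pi) * L2_set u K"
proof -
  interpret prob_space "std_gauss K" by (rule prob_space_std_gauss)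
  \<comment> \<open>Zero coefficients are dropped: they would contribute normal laws of standard
    deviation 0, which have no density.\<close>
  define J where "J = {k \<in> K. u k \<noteq> 0}"
  have J: "finite J" "J \<subseteq> K" "\<And>k. k \<in> J \<Longrightarrow> u k \<noteq> 0" using K by (auto simp: J_def)
  have sumJ: "(\<Sum>k\<in>K. u k * g k) = (\<Sum>k\<in>J. u k * g k)" for g
    using K by (intro sum.mono_neutral_right) (auto simp: J_def)
  have L2J: "L2_set u K = sqrt (\<Sum>k\<in>J. (\<bar>u k\<bar> * 1)\<^sup>2)"
    using K unfolding L2_set_def J_def by (auto intro!: sum.mono_neutral_right)
  show ?thesis
  proof (cases "J = {}")
    case True
    then show ?thesis using L2J by (simp add: sumJ)
  next
    case False
    let ?s = "L2_set u K"
    have s: "?s > 0"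
      unfolding L2J using J False by (auto intro!: sum_pos)
    have "indep_vars (\<lambda>_. borel) (\<lambda>k g. u k * g k) J"
      by (rule indep_vars_compose2[OF indep_vars_subset[OF indep_vars_std_gauss[OF K] J(2)]]) simp
    moreover have "distributed (std_gauss K) lborel (\<lambda>g. u k * g k) (normal_density 0 (\<bar>u k\<bar> * 1))" if "k \<in> J" for k
      using normal_density_affine[OF distributed_std_gauss_component, of k "u k" 0] that J by auto
    ultimately have "distributed (std_gauss K) lborel (\<lambda>g. \<Sum>k\<in>J. u k * g k) (normal_density (\<Sum>k\<in>J. 0) ?s)"
      unfolding L2J using J False by (intro sum_indep_normal) auto
    then have "(\<integral>g. \<bar>\<Sum>k\<in>J. u k * g k\<bar> \<partial>std_gauss K) = (\<integral>x. normal_density 0 ?s x * \<bar>x\<bar> \<partial>lborel)"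
      by (subst distributed_integral[symmetric, where g = abs]) auto
    also have "\<dots> = sqrt (2 / pi) * ?s"
      using integral_normal_moment_abs_odd[OF s, of 0 0] by simp
    finally show ?thesis by (simp add: sumJ)
  qed
qed

text \<open>Completing the square: tilting by \<open>exp (t * x)\<close> moves the mean to
  \<open>t\<close>.\<close>

lemma nn_integral_std_normal_exp:
  "(\<integral>\<^sup>+x. ennreal (exp (t * x)) \<partial>density lborel std_normal_density) = ennreal (exp (t\<^sup>2 / 2))"
proof -
  have eq: "std_normal_density x * exp (t * x) = exp (t\<^sup>2 / 2) * normal_density t 1 x" for x
    unfolding normal_density_def by (simp add: exp_add[symmetric] power2_eq_square field_simps)
  have "(\<integral>\<^sup>+x. ennreal (exp (t * x)) \<partial>density lborel std_normal_density)
      = (\<integral>\<^sup>+x. ennreal (exp (t\<^sup>2 / 2)) * ennreal (normal_density t 1 x) \<partial>lborel)"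
    by (subst nn_integral_density) (auto simp: ennreal_mult'[symmetric] eq)
  also have "\<dots> = ennreal (exp (t\<^sup>2 / 2))"
    by (subst nn_integral_cmult) (auto simp: nn_integral_eq_integral)
  finally show ?thesis .
qed

lemma nn_integral_std_gauss_exp_linear:
  assumes "finite K"
  shows "(\<integral>\<^sup>+g. ennreal (exp (\<Sum>k\<in>K. t k * g k)) \<partial>std_gauss K) = ennreal (exp ((\<Sum>k\<in>K. (t k)\<^sup>2) / 2))"
proof -
  interpret std_normal_prod: product_prob_space "\<lambda>_::'a. density lborel (\<lambda>x. ennreal (std_normal_density x))"
    by standard
  have "(\<integral>\<^sup>+g. ennreal (exp (\<Sum>k\<in>K. t k * g k)) \<partial>std_gauss K)
      = (\<integral>\<^sup>+g. (\<Prod>k\<in>K. ennreal (exp (t k * g k))) \<partial>std_gauss K)"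
    by (simp add: exp_sum assms prod_ennreal)
  also have "\<dots> = (\<Prod>k\<in>K. ennreal (exp ((t k)\<^sup>2 / 2)))"
    unfolding std_gauss_def
    by (subst std_normal_prod.product_nn_integral_prod[OF assms, where f = "\<lambda>k x. ennreal (exp (t k * x))"])
      (simp_all add: nn_integral_std_normal_exp)
  also have "\<dots> = ennreal (exp ((\<Sum>k\<in>K. (t k)\<^sup>2) / 2))"
    by (simp add: prod_ennreal exp_sum[symmetric] assms sum_divide_distrib)
  finally show ?thesis .
qed

section \<open>Gaussian relative entropy and the variational principle\<close>

text \<open>Coordinates outside \<open>J\<close> integrate to 1. The cases used are \<open>J\<close>
  empty for the total mass, the coordinates of one monomial, and a singleton for a log density
  ratio.\<close>

lemma has_bochner_integral_prod_normal_density: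
  fixes h :: "'p \<Rightarrow> real \<Rightarrow> real"
  assumes P: "finite P" "J \<subseteq> P" and \<sigma>: "\<And>p. p \<in> P \<Longrightarrow> 0 < \<sigma> p"
    and h: "\<And>p. p \<in> J \<Longrightarrow> has_bochner_integral lborel (\<lambda>x. normal_density (\<mu> p) (\<sigma> p) x * h p x) (c p)"
  shows "has_bochner_integral (Pi\<^sub>M P (\<lambda>_. lborel))
    (\<lambda>v. (\<Prod>p\<in>P. normal_density (\<mu> p) (\<sigma> p) (v p)) * (\<Prod>p\<in>J. h p (v p))) (\<Prod>p\<in>J. c p)"
proof -
  interpret product_sigma_finite "\<lambda>_::'p. lborel :: real measure" by standard
  let ?f = "\<lambda>p x. normal_density (\<mu> p) (\<sigma> p) x * (if p \<in> J then h p x else 1)"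
  have f: "has_bochner_integral lborel (?f p) (if p \<in> J then c p else 1)" if "p \<in> P" for p
    using h[of p] \<sigma>[OF that] by (cases "p \<in> J") (auto simp: has_bochner_integral_iff)
  have split: "(\<Prod>p\<in>P. if p \<in> J then g p else 1) = (\<Prod>p\<in>J. g p)" for g :: "'p \<Rightarrow> real"
    using P by (subst prod.inter_restrict[symmetric]) (auto simp: Int_absorb1)
  have "has_bochner_integral (Pi\<^sub>M P (\<lambda>_. lborel)) (\<lambda>v. \<Prod>p\<in>P. ?f p (v p)) (\<Prod>p\<in>P. if p \<in> J then c p else 1)"
    using f P product_integral_prod[of P ?f] product_integrable_prod[of P ?f]
    by (auto simp: has_bochner_integral_iff intro!: prod.cong)
  then show ?thesis by (simp add: prod.distrib split)
qed

text \<open>The exponent is the logarithm of the density ratio; over a product of coordinates these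
  exponents add up.\<close>

lemma normal_density_eq_mult_exp:
  assumes "0 < \<sigma>" "0 < \<tau>"
  shows "normal_density 0 \<tau> x
    = normal_density \<mu> \<sigma> x * exp (ln (\<sigma> / \<tau>) - x\<^sup>2 / (2 * \<tau>\<^sup>2) + (x - \<mu>)\<^sup>2 / (2 * \<sigma>\<^sup>2))"
proof -
  have "exp (ln (\<sigma> / \<tau>) - y + z) = \<sigma> / \<tau> * exp (- y) / exp (- z)" for y z
    using assms unfolding exp_add exp_diff by (simp add: exp_minus divide_inverse)
  from this[of "x\<^sup>2 / (2 * \<tau>\<^sup>2)" "(x - \<mu>)\<^sup>2 / (2 * \<sigma>\<^sup>2)"] show ?thesis
    using assms by (simp add: normal_density_def real_sqrt_mult)
qed

text \<open>Expand \<open>x\<^sup>2 = (x - \<mu>)\<^sup>2 + 2 * \<mu> * x - \<mu>\<^sup>2\<close>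
  and use the variance, the mean and the mass.\<close>

lemma has_bochner_integral_normal_density_square:
  assumes "0 < \<sigma>"
  shows "has_bochner_integral lborel (\<lambda>x. normal_density \<mu> \<sigma> x * x\<^sup>2) (\<mu>\<^sup>2 + \<sigma>\<^sup>2)"
proof -
  have "has_bochner_integral lborel (\<lambda>x. normal_density \<mu> \<sigma> x * (x - \<mu>)^2) (\<sigma>\<^sup>2)"
    using normal_moment_even[OF assms, of \<mu> 1] by simp
  moreover have "has_bochner_integral lborel (normal_density \<mu> \<sigma>) 1"
    using normal_moment_even[OF assms, of \<mu> 0] by simp
  ultimately have "has_bochner_integral lborel
      (\<lambda>x. normal_density \<mu> \<sigma> x * (x - \<mu>)^2 + (normal_density \<mu> \<sigma> x * x * (2 * \<mu>) - normal_density \<mu> \<sigma> x * \<mu>\<^sup>2))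
      (\<sigma>\<^sup>2 + (\<mu> * (2 * \<mu>) - 1 * \<mu>\<^sup>2))"
    by (intro has_bochner_integral_add has_bochner_integral_diff has_bochner_integral_mult_left normal_moment_nz_1 assms)
  then show ?thesis by (simp add: power2_eq_square algebra_simps)
qed

text \<open>The value is minus the relative entropy of the normal law with parameters
  \<open>\<mu>\<close>, \<open>\<sigma>\<close> with respect to the one with parameters
  \<open>0\<close>, \<open>\<tau>\<close>.\<close>

lemma has_bochner_integral_normal_density_log_ratio:
  assumes "0 < \<sigma>" "0 < \<tau>"
  shows "has_bochner_integral lborel
    (\<lambda>x. normal_density \<mu> \<sigma> x * (ln (\<sigma> / \<tau>) - x\<^sup>2 / (2 * \<tau>\<^sup>2) + (x - \<mu>)\<^sup>2 / (2 * \<sigma>\<^sup>2)))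
    (ln (\<sigma> / \<tau>) - (\<mu>\<^sup>2 + \<sigma>\<^sup>2) / (2 * \<tau>\<^sup>2) + 1 / 2)"
proof -
  have "has_bochner_integral lborel (\<lambda>x. normal_density \<mu> \<sigma> x * (x - \<mu>)^2) (\<sigma>\<^sup>2)"
    using normal_moment_even[OF assms(1), of \<mu> 1] by simp
  moreover have "has_bochner_integral lborel (normal_density \<mu> \<sigma>) 1"
    using normal_moment_even[OF assms(1), of \<mu> 0] by simp
  ultimately have "has_bochner_integral lborel
      (\<lambda>x. normal_density \<mu> \<sigma> x * ln (\<sigma> / \<tau>) - normal_density \<mu> \<sigma> x * x\<^sup>2 * (1 / (2 * \<tau>\<^sup>2))
        + normal_density \<mu> \<sigma> x * (x - \<mu>)^2 * (1 / (2 * \<sigma>\<^sup>2)))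
      (1 * ln (\<sigma> / \<tau>) - (\<mu>\<^sup>2 + \<sigma>\<^sup>2) * (1 / (2 * \<tau>\<^sup>2)) + \<sigma>\<^sup>2 * (1 / (2 * \<sigma>\<^sup>2)))"
    by (intro has_bochner_integral_add has_bochner_integral_diff has_bochner_integral_mult_left
        has_bochner_integral_normal_density_square assms)
  then show ?thesis using assms by (simp add: distrib_left right_diff_distrib)
qed

text \<open>Gibbs' variational principle for Gaussian product densities: tilting the density centred at
  \<open>0\<close> into the one centred at \<open>\<mu>\<close> costs their relative entropy, and a multilinear function has at
  \<open>\<mu>\<close> exactly its mean under the latter.\<close>

lemma multilinear_gaussian_variational:
  fixes D :: nat and n :: "nat \<Rightarrow> nat" and b c :: real and \<mu> \<sigma> \<tau> :: "nat \<times> nat \<Rightarrow> real" and Y :: "(nat \<Rightarrow> nat) \<Rightarrow> real"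
  defines "P \<equiv> SIGMA d:{1..D}. {1..n d}"
  defines "A \<equiv> \<lambda>v. (\<Sum>k\<in>tensor_index D n. b * Y k * (\<Prod>d=1..D. v (d, k d)) - c / 2 * (\<Prod>d=1..D. (v (d, k d))\<^sup>2))"
  assumes \<sigma>: "\<And>p. p \<in> P \<Longrightarrow> 0 < \<sigma> p" and \<tau>: "\<And>p. p \<in> P \<Longrightarrow> 0 < \<tau> p" and c: "0 < c"
  shows "integrable (Pi\<^sub>M P (\<lambda>_. lborel)) (\<lambda>v. (\<Prod>p\<in>P. normal_density 0 (\<tau> p) (v p)) * exp (A v))"
    and "(\<Sum>k\<in>tensor_index D n. b * Y k * (\<Prod>d=1..D. \<mu> (d, k d)) - c / 2 * (\<Prod>d=1..D. (\<mu> (d, k d))\<^sup>2 + (\<sigma> (d, k d))\<^sup>2))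
        + (\<Sum>p\<in>P. ln (\<sigma> p / \<tau> p) - ((\<mu> p)\<^sup>2 + (\<sigma> p)\<^sup>2) / (2 * (\<tau> p)\<^sup>2) + 1 / 2)
      \<le> (\<integral>v. (\<Prod>p\<in>P. normal_density 0 (\<tau> p) (v p)) * exp (A v) \<partial>Pi\<^sub>M P (\<lambda>_. lborel)) - 1"
proof -
  let ?L = "Pi\<^sub>M P (\<lambda>_. lborel :: real measure)"
  let ?K = "tensor_index D n"
  define q where "q = (\<lambda>v. \<Prod>p\<in>P. normal_density (\<mu> p) (\<sigma> p) (v p))"
  define q0 where "q0 = (\<lambda>v. \<Prod>p\<in>P. normal_density 0 (\<tau> p) (v p))"
  define l where "l p x = ln (\<sigma> p / \<tau> p) - x\<^sup>2 / (2 * (\<tau> p)\<^sup>2) + (x - \<mu> p)\<^sup>2 / (2 * (\<sigma> p)\<^sup>2)" for p x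
  have P: "finite P" by (simp add: P_def)
  have K: "finite ?K" by (simp add: tensor_index_def finite_PiE)
  have q0_int: "integrable ?L q0"
    using has_bochner_integral_prod_normal_density[OF P empty_subsetI, of \<tau> "\<lambda>_. 0"] \<tau>
    by (simp add: has_bochner_integral_iff q0_def)
  have q_int: "has_bochner_integral ?L q 1"
    using has_bochner_integral_prod_normal_density[OF P empty_subsetI, of \<sigma> \<mu>] \<sigma>
    by (simp add: q_def)
  \<comment> \<open>The pairs \<open>(d, k d)\<close> are distinct coordinates for distinct
    \<open>d\<close>, so the integral factors over \<open>d\<close>. This is where multilinearity
    enters.\<close>
  have monom: "has_bochner_integral ?L (\<lambda>v. q v * (\<Prod>d=1..D. g (v (d, k d)))) (\<Prod>d=1..D. e (d, k d))"
    if k: "k \<in> ?K" and g: "\<And>p. p \<in> P \<Longrightarrow> has_bochner_integral lborel (\<lambda>x. normal_density (\<mu> p) (\<sigma> p) x * g x) (e p)"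
    for k and g :: "real \<Rightarrow> real" and e
  proof -
    have inj: "inj_on (\<lambda>d. (d, k d)) {1..D}" by (auto simp: inj_on_def)
    have sub: "(\<lambda>d. (d, k d)) ` {1..D} \<subseteq> P" using k by (auto simp: P_def tensor_index_def PiE_def Pi_def)
    have "has_bochner_integral ?L (\<lambda>v. q v * (\<Prod>p\<in>(\<lambda>d. (d, k d)) ` {1..D}. g (v p))) (\<Prod>p\<in>(\<lambda>d. (d, k d)) ` {1..D}. e p)"
      unfolding q_def using sub by (intro has_bochner_integral_prod_normal_density P \<sigma> g) auto
    then show ?thesis using inj by (simp add: prod.reindex)
  qed
  have mean: "has_bochner_integral ?L (\<lambda>v. q v * (\<Prod>d=1..D. v (d, k d))) (\<Prod>d=1..D. \<mu> (d, k d))" if "k \<in> ?K" for k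
    using monom[OF that, of "\<lambda>x. x" \<mu>] \<sigma> normal_moment_nz_1 by blast
  have square: "has_bochner_integral ?L (\<lambda>v. q v * (\<Prod>d=1..D. (v (d, k d))\<^sup>2)) (\<Prod>d=1..D. (\<mu> (d, k d))\<^sup>2 + (\<sigma> (d, k d))\<^sup>2)"
    if "k \<in> ?K" for k
    using monom[OF that, of "\<lambda>x. x\<^sup>2" "\<lambda>p. (\<mu> p)\<^sup>2 + (\<sigma> p)\<^sup>2"] \<sigma> has_bochner_integral_normal_density_square by blast
  have logs: "has_bochner_integral ?L (\<lambda>v. q v * l p (v p)) (ln (\<sigma> p / \<tau> p) - ((\<mu> p)\<^sup>2 + (\<sigma> p)\<^sup>2) / (2 * (\<tau> p)\<^sup>2) + 1 / 2)"
    if "p \<in> P" for p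
    using has_bochner_integral_prod_normal_density[OF P, of "{p}" \<sigma> \<mu> l] \<sigma>
      has_bochner_integral_normal_density_log_ratio[OF \<sigma>[OF that] \<tau>[OF that], of "\<mu> p"] that
    by (simp add: q_def l_def)
  have A_meas [measurable]: "A \<in> borel_measurable ?L"
  proof -
    have kP: "(d, k d) \<in> P" if "k \<in> ?K" "d \<in> {1..D}" for k d
      using that by (auto simp: P_def tensor_index_def PiE_def Pi_def)
    have comp: "(\<lambda>v. v p) \<in> borel_measurable ?L" if "p \<in> P" for p
      using measurable_component_singleton[OF that, of "\<lambda>_. lborel :: real measure"] by simp
    have "(\<lambda>v. \<Prod>d=1..D. v (d, k d)) \<in> borel_measurable ?L"
      "(\<lambda>v. \<Prod>d=1..D. (v (d, k d))\<^sup>2) \<in> borel_measurable ?L" if "k \<in> ?K" for k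
      using comp[OF kP[OF that]] by (auto intro!: borel_measurable_prod borel_measurable_power)
    then show ?thesis
      unfolding A_def by (auto intro!: borel_measurable_sum borel_measurable_diff borel_measurable_times)
  qed
  \<comment> \<open>Because \<open>0 < c\<close>, the quadratic term bounds the exponent uniformly
    in \<open>v\<close>, whatever the degree \<open>D\<close>; this makes the exponential
    integrable.\<close>
  have A_le: "A v \<le> (\<Sum>k\<in>?K. (b * Y k)\<^sup>2 / (2 * c))" for v
  proof -
    have "a * w - c / 2 * w\<^sup>2 \<le> a\<^sup>2 / (2 * c)" for a w :: real
    proof -
      have "0 \<le> (a - c * w)\<^sup>2 / (2 * c)" using c by simp
      then show ?thesis using c by (simp add: power2_eq_square field_simps)
    qed
    from this[of "b * Y _" "\<Prod>d=1..D. v (d, _ d)"] show ?thesis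
      unfolding A_def prod_power_distrib by (intro sum_mono)
  qed
  have q0_nonneg: "0 \<le> q0 v" and q_nonneg: "0 \<le> q v" for v
    unfolding q_def q0_def by (auto intro!: prod_nonneg)
  have int: "integrable ?L (\<lambda>v. q0 v * exp (A v))"
  proof (rule Bochner_Integration.integrable_bound)
    show "integrable ?L (\<lambda>v. q0 v * exp (\<Sum>k\<in>?K. (b * Y k)\<^sup>2 / (2 * c)))"
      using q0_int by simp
    show "(\<lambda>v. q0 v * exp (A v)) \<in> borel_measurable ?L"
      using borel_measurable_integrable[OF q0_int] by measurable
  qed (use q0_nonneg A_le in \<open>auto simp: abs_mult intro!: AE_I2 mult_left_mono\<close>)
  then show "integrable ?L (\<lambda>v. (\<Prod>p\<in>P. normal_density 0 (\<tau> p) (v p)) * exp (A v))"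
    unfolding q0_def .
  have eq: "q v * (A v + (\<Sum>p\<in>P. l p (v p)))
    = (\<Sum>k\<in>?K. b * Y k * (q v * (\<Prod>d=1..D. v (d, k d))) - c / 2 * (q v * (\<Prod>d=1..D. (v (d, k d))\<^sup>2)))
      + (\<Sum>p\<in>P. q v * l p (v p))" for v
    unfolding A_def distrib_left sum_distrib_left by (intro arg_cong2[where f = "(+)"] sum.cong) (auto simp: algebra_simps)
  have lhs: "has_bochner_integral ?L (\<lambda>v. q v * (A v + (\<Sum>p\<in>P. l p (v p))))
     ((\<Sum>k\<in>?K. b * Y k * (\<Prod>d=1..D. \<mu> (d, k d)) - c / 2 * (\<Prod>d=1..D. (\<mu> (d, k d))\<^sup>2 + (\<sigma> (d, k d))\<^sup>2))
        + (\<Sum>p\<in>P. ln (\<sigma> p / \<tau> p) - ((\<mu> p)\<^sup>2 + (\<sigma> p)\<^sup>2) / (2 * (\<tau> p)\<^sup>2) + 1 / 2))"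
    unfolding eq
    by (intro has_bochner_integral_add has_bochner_integral_sum has_bochner_integral_diff
        has_bochner_integral_mult_right mean square logs)
  \<comment> \<open>The variational principle holds pointwise, as \<open>t + 1 \<le> exp t\<close>
    with \<open>t\<close> the exponent plus the log density ratio. The bound then involves the
    partition function minus 1 instead of its logarithm, and so can be averaged over the Gaussian
    data directly.\<close>
  have le: "q v * (A v + (\<Sum>p\<in>P. l p (v p))) \<le> q0 v * exp (A v) - q v" for v
  proof -
    have "q0 v = q v * exp (\<Sum>p\<in>P. l p (v p))"
      unfolding q0_def q_def exp_sum[OF P] prod.distrib[symmetric] l_def
      by (intro prod.cong normal_density_eq_mult_exp \<sigma> \<tau> refl)
    then have "q0 v * exp (A v) - q v = q v * (exp (A v + (\<Sum>p\<in>P. l p (v p))) - 1)"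
      by (simp add: exp_add algebra_simps)
    moreover have "A v + (\<Sum>p\<in>P. l p (v p)) \<le> exp (A v + (\<Sum>p\<in>P. l p (v p))) - 1"
      using exp_ge_add_one_self[of "A v + (\<Sum>p\<in>P. l p (v p))"] by linarith
    ultimately show ?thesis
      using q_nonneg by (simp add: mult_left_mono)
  qed
  have "(\<integral>v. q v * (A v + (\<Sum>p\<in>P. l p (v p))) \<partial>?L) \<le> (\<integral>v. q0 v * exp (A v) - q v \<partial>?L)"
    using lhs int q_int le by (intro integral_mono) (auto simp: has_bochner_integral_iff)
  then show "(\<Sum>k\<in>?K. b * Y k * (\<Prod>d=1..D. \<mu> (d, k d)) - c / 2 * (\<Prod>d=1..D. (\<mu> (d, k d))\<^sup>2 + (\<sigma> (d, k d))\<^sup>2))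
        + (\<Sum>p\<in>P. ln (\<sigma> p / \<tau> p) - ((\<mu> p)\<^sup>2 + (\<sigma> p)\<^sup>2) / (2 * (\<tau> p)\<^sup>2) + 1 / 2)
      \<le> (\<integral>v. (\<Prod>p\<in>P. normal_density 0 (\<tau> p) (v p)) * exp (A v) \<partial>?L) - 1"
    using lhs int q_int by (simp add: has_bochner_integral_iff q0_def)
qed

text \<open>With \<open>c = card I * b\<^sup>2\<close> the quadratic term of the exponent cancels the moment generating function
  of the linear one, for every \<open>v\<close>.\<close>

lemma nn_integral_multilinear_gaussian:
  fixes D :: nat and n :: "nat \<Rightarrow> nat" and b c :: real and \<tau> :: "nat \<times> nat \<Rightarrow> real" and I :: "'i set"
  defines "P \<equiv> SIGMA d:{1..D}. {1..n d}"
  defines "A \<equiv> \<lambda>Y v. (\<Sum>k\<in>tensor_index D n. b * Y k * (\<Prod>d=1..D. v (d, k d)) - c / 2 * (\<Prod>d=1..D. (v (d, k d))\<^sup>2))"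
  defines "f \<equiv> \<lambda>x v. ennreal ((\<Prod>p\<in>P. normal_density 0 (\<tau> p) (v p)) * exp (A (\<lambda>k. \<Sum>i\<in>I. x i k) v))"
  assumes \<tau>: "\<And>p. p \<in> P \<Longrightarrow> 0 < \<tau> p" and I: "finite I" and c: "c = real (card I) * b\<^sup>2"
  shows "(\<lambda>x. \<integral>\<^sup>+v. f x v \<partial>Pi\<^sub>M P (\<lambda>_. lborel)) \<in> borel_measurable (Pi\<^sub>M I (\<lambda>_. std_gauss (tensor_index D n)))"
    and "(\<integral>\<^sup>+x. (\<integral>\<^sup>+v. f x v \<partial>Pi\<^sub>M P (\<lambda>_. lborel)) \<partial>Pi\<^sub>M I (\<lambda>_. std_gauss (tensor_index D n))) = 1"
proof -
  let ?L = "Pi\<^sub>M P (\<lambda>_. lborel :: real measure)"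
  let ?K = "tensor_index D n"
  let ?G = "Pi\<^sub>M I (\<lambda>_. std_gauss ?K)"
  have P: "finite P" by (simp add: P_def)
  have K: "finite ?K" by (simp add: tensor_index_def finite_PiE)
  interpret L: product_sigma_finite "\<lambda>_::nat \<times> nat. lborel :: real measure" by standard
  interpret Lf: finite_product_sigma_finite "\<lambda>_::nat \<times> nat. lborel :: real measure" P by standard (rule P)
  interpret \<gamma>: prob_space "std_gauss ?K" by (rule prob_space_std_gauss)
  interpret G: product_prob_space "\<lambda>_::'i. std_gauss ?K" by standard
  interpret Gf: finite_product_prob_space "\<lambda>_::'i. std_gauss ?K" I by standard (rule I)
  interpret pair_sigma_finite ?G ?L by standard
  have kP: "(d, k d) \<in> P" if "k \<in> ?K" "d \<in> {1..D}" for k d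
    using that by (auto simp: P_def tensor_index_def PiE_def Pi_def)
  have vm: "(\<lambda>v. v p) \<in> borel_measurable ?L" if "p \<in> P" for p
    using measurable_component_singleton[OF that, of "\<lambda>_. lborel :: real measure"] by simp
  have v: "(\<lambda>z. snd z p) \<in> borel_measurable (?G \<Otimes>\<^sub>M ?L)" if "p \<in> P" for p
    by (rule measurable_compose[OF measurable_snd vm[OF that]])
  have x: "(\<lambda>z. fst z i k) \<in> borel_measurable (?G \<Otimes>\<^sub>M ?L)" if "i \<in> I" "k \<in> ?K" for i k
    by (rule measurable_compose[OF measurable_fst
          measurable_compose[OF measurable_component_singleton[OF that(1)] measurable_std_gauss_component[OF that(2)]]])
  have "(\<lambda>z. \<Prod>d=1..D. snd z (d, k d)) \<in> borel_measurable (?G \<Otimes>\<^sub>M ?L)"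
    "(\<lambda>z. \<Prod>d=1..D. (snd z (d, k d))\<^sup>2) \<in> borel_measurable (?G \<Otimes>\<^sub>M ?L)" if "k \<in> ?K" for k
    using v[OF kP[OF that]] by (auto intro!: borel_measurable_prod borel_measurable_power)
  then have "(\<lambda>z. A (\<lambda>k. \<Sum>i\<in>I. fst z i k) (snd z)) \<in> borel_measurable (?G \<Otimes>\<^sub>M ?L)"
    using x unfolding A_def by (auto intro!: borel_measurable_sum borel_measurable_diff borel_measurable_times)
  moreover have "(\<lambda>z. \<Prod>p\<in>P. normal_density 0 (\<tau> p) (snd z p)) \<in> borel_measurable (?G \<Otimes>\<^sub>M ?L)"
    using v by (auto intro!: borel_measurable_prod measurable_compose[OF _ borel_measurable_normal_density])
  ultimately have meas: "case_prod f \<in> borel_measurable (?G \<Otimes>\<^sub>M ?L)"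
    unfolding f_def case_prod_beta by (auto intro!: measurable_compose[OF _ borel_measurable_exp])
  show "(\<lambda>x. \<integral>\<^sup>+v. f x v \<partial>?L) \<in> borel_measurable ?G"
    using Lf.borel_measurable_nn_integral[OF meas] by simp
  have q: "(\<integral>\<^sup>+v. ennreal (\<Prod>p\<in>P. normal_density 0 (\<tau> p) (v p)) \<partial>?L) = 1"
    using has_bochner_integral_prod_normal_density[OF P empty_subsetI, of \<tau> "\<lambda>_. 0"] \<tau>
    by (subst nn_integral_eq_integral) (auto simp: has_bochner_integral_iff intro!: prod_nonneg)
  have inner: "(\<integral>\<^sup>+x. f x v \<partial>?G) = ennreal (\<Prod>p\<in>P. normal_density 0 (\<tau> p) (v p))" for v
  proof -
    let ?q = "\<Prod>p\<in>P. normal_density 0 (\<tau> p) (v p)"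
    define w where "w k = (\<Prod>d=1..D. v (d, k d))" for k
    have "A (\<lambda>k. \<Sum>i\<in>I. x i k) v = - (c / 2) * (\<Sum>k\<in>?K. (w k)\<^sup>2) + (\<Sum>i\<in>I. \<Sum>k\<in>?K. (b * w k) * x i k)" for x
      unfolding A_def sum_subtractf w_def[symmetric] prod_power_distrib[symmetric] sum_distrib_left sum_distrib_right
      by (subst sum.swap[of _ ?K]) (simp add: sum_distrib_left sum_negf algebra_simps)
    then have "exp (A (\<lambda>k. \<Sum>i\<in>I. x i k) v) = exp (- (c / 2) * (\<Sum>k\<in>?K. (w k)\<^sup>2))
        * (\<Prod>i\<in>I. exp (\<Sum>k\<in>?K. (b * w k) * x i k))" for x
      by (simp only: exp_add exp_sum[OF I])
    then have f: "f x v = ennreal (?q * exp (- (c / 2) * (\<Sum>k\<in>?K. (w k)\<^sup>2)))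
        * (\<Prod>i\<in>I. ennreal (exp (\<Sum>k\<in>?K. (b * w k) * x i k)))" for x
      unfolding f_def by (simp only: prod_ennreal exp_ge_zero ennreal_mult''[symmetric] prod_nonneg mult.assoc)
    have em: "(\<lambda>g. ennreal (exp (\<Sum>k\<in>?K. (b * w k) * g k))) \<in> borel_measurable (std_gauss ?K)"
      by (intro measurable_compose[OF _ measurable_ennreal] measurable_compose[OF _ borel_measurable_exp]
          borel_measurable_sum borel_measurable_times borel_measurable_const measurable_std_gauss_component)
    have "(\<integral>\<^sup>+x. f x v \<partial>?G) = ennreal (?q * exp (- (c / 2) * (\<Sum>k\<in>?K. (w k)\<^sup>2)))
        * (\<Prod>i\<in>I. ennreal (exp ((\<Sum>k\<in>?K. (b * w k)\<^sup>2) / 2)))"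
      unfolding f
    proof (subst nn_integral_cmult)
      show "(\<lambda>x. \<Prod>i\<in>I. ennreal (exp (\<Sum>k\<in>?K. (b * w k) * x i k))) \<in> borel_measurable ?G"
        by (intro borel_measurable_prod_ennreal measurable_compose[where N = "std_gauss ?K", OF _ em]
            measurable_component_singleton)
      show "ennreal (?q * exp (- (c / 2) * (\<Sum>k\<in>?K. (w k)\<^sup>2)))
          * (\<integral>\<^sup>+x. (\<Prod>i\<in>I. ennreal (exp (\<Sum>k\<in>?K. (b * w k) * x i k))) \<partial>?G)
        = ennreal (?q * exp (- (c / 2) * (\<Sum>k\<in>?K. (w k)\<^sup>2)))
          * (\<Prod>i\<in>I. ennreal (exp ((\<Sum>k\<in>?K. (b * w k)\<^sup>2) / 2)))"
        by (subst G.product_nn_integral_prod[OF I em]) (simp add: nn_integral_std_gauss_exp_linear[OF K])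
    qed
    also have "(\<Prod>i\<in>I. ennreal (exp ((\<Sum>k\<in>?K. (b * w k)\<^sup>2) / 2))) = ennreal (exp (c / 2 * (\<Sum>k\<in>?K. (w k)\<^sup>2)))"
      by (simp add: ennreal_power exp_of_nat_mult[symmetric] c power_mult_distrib sum_distrib_left[symmetric])
    finally show ?thesis
      by (simp add: ennreal_mult[symmetric] prod_nonneg mult.assoc exp_add[symmetric])
  qed
  \<comment> \<open>By Tonelli the Gaussian data are integrated first, which leaves the reference
    density, of mass 1.\<close>
  show "(\<integral>\<^sup>+x. (\<integral>\<^sup>+v. f x v \<partial>?L) \<partial>?G) = 1"
    using Fubini'[OF meas] by (simp add: inner q)
qed

section \<open>The expected operator norm of a Gaussian tensor\<close>

text \<open>Concavity of \<open>ln\<close> at the points \<open>1\<close> and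
  \<open>1 + 1 / s\<close> with weights \<open>1 - s\<close> and \<open>s\<close>, whose weighted
  mean is 2.\<close>

lemma mult_ln_one_plus_inverse_le:
  fixes s :: real
  assumes "0 < s" "s \<le> 1"
  shows "s * ln (1 + 1 / s) \<le> ln 2"
proof -
  have "(1 - s) * ln 1 + s * ln (1 + 1 / s) \<le> ln ((1 - s) *\<^sub>R 1 + s *\<^sub>R (1 + 1 / s))"
    using assms by (intro concave_onD[OF ln_concave]) (auto intro: add_pos_pos)
  moreover have "(1 - s) *\<^sub>R 1 + s *\<^sub>R (1 + 1 / s) = 2"
    using assms by (simp add: algebra_simps)
  ultimately show ?thesis by (simp only: ln_one mult_zero_right add_0)
qed

definition unit_vectors :: "nat \<Rightarrow> (nat \<Rightarrow> nat) \<Rightarrow> (nat \<Rightarrow> nat \<Rightarrow> real) \<Rightarrow> bool" where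
  "unit_vectors D n u \<longleftrightarrow> (\<forall>d\<in>{1..D}. L2_set (u d) {1..n d} = 1)"

text \<open>An integrable majorant \<open>W\<close> replaces the operator norm of the sum, so the
  measurability of a supremum over unit vectors never arises. It is affine in the partition function
  \<open>Z\<close>, whose mean is exactly 1.\<close>

lemma gaussian_operator_norm_bound:
  fixes I :: "'i set" and D :: nat and n :: "nat \<Rightarrow> nat"
  defines "N \<equiv> Pi\<^sub>M I (\<lambda>_. std_gauss (tensor_index D n))"
  assumes D: "0 < D" and n: "\<forall>d\<in>{1..D}. n d > 0" and I: "finite I" "I \<noteq> {}"
  obtains W where "integrable N W"
    "integral\<^sup>L N W \<le> sqrt 2 * sqrt (real (card I)) * (\<Sum>d=1..D. sqrt (real (n d)))"
    "\<And>x u. unit_vectors D n u \<Longrightarrow>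
       tensor_inner D n (\<lambda>k. \<Sum>i\<in>I. x i k) (rank_one D n u) \<le> W x"
proof -
  define S where "S = (\<Sum>d=1..D. sqrt (real (n d)))"
  define m where "m = real (card I)"
  \<comment> \<open>The noise has variance \<open>s d / n d\<close> and the reference density variance \<open>(1 + s d) / n d\<close>, the mean
    square of an entry of a smoothed unit vector; the entropy is then \<open>\<Sum>d. n d * ln (1 + 1 / s d) / 2\<close>.
    The choice \<open>\<Sum>d. s d = 1\<close> keeps \<open>\<Prod>d. 1 + s d \<le> exp 1\<close>.\<close>
  define s where "s d = sqrt (real (n d)) / S" for d
  define P where "P = (SIGMA d:{1..D}. {1..n d})"
  define \<sigma> where "\<sigma> p = sqrt (s (fst p) / n (fst p))" for p :: "nat \<times> nat"
  define \<tau> where "\<tau> p = sqrt ((1 + s (fst p)) / n (fst p))" for p :: "nat \<times> nat"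
  \<comment> \<open>Nearly optimal: \<open>C / b\<close> is at most
    \<open>m * b / 2 * exp 1 + S\<^sup>2 * ln 2 / (2 * b)\<close>, whose minimum is close to this
    value.\<close>
  define b where "b = S / (2 * sqrt m)"
  define c where "c = m * b\<^sup>2"
  let ?K = "tensor_index D n"
  let ?L = "Pi\<^sub>M P (\<lambda>_. lborel :: real measure)"
  define f where "f Y v = (\<Prod>p\<in>P. normal_density 0 (\<tau> p) (v p))
      * exp (\<Sum>k\<in>?K. b * Y k * (\<Prod>d=1..D. v (d, k d)) - c / 2 * (\<Prod>d=1..D. (v (d, k d))\<^sup>2))"
    for Y :: "(nat \<Rightarrow> nat) \<Rightarrow> real" and v
  define Z where "Z Y = (\<integral>v. f Y v \<partial>?L)" for Y
  \<comment> \<open>The mean of the quadratic term plus the relative entropy. Both are the same for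
    all unit vectors, so one \<open>W\<close> serves every \<open>u\<close>.\<close>
  define C where "C = c / 2 * (\<Prod>d=1..D. 1 + s d) + (\<Sum>d=1..D. real (n d) * ln (1 + 1 / s d)) / 2"
  define W where "W x = (Z (\<lambda>k. \<Sum>i\<in>I. x i k) - 1 + C) / b" for x :: "'i \<Rightarrow> (nat \<Rightarrow> nat) \<Rightarrow> real"
  have m: "m > 0" using I by (simp add: m_def card_gt_0_iff)
  have S: "S > 0" unfolding S_def using D n by (intro sum_pos) auto
  have b: "b > 0" and c_eq: "c = S\<^sup>2 / 4" using S m by (auto simp: b_def c_def power_divide power_mult_distrib)
  have c: "c > 0" unfolding c_eq using S by simp
  have s: "s d > 0" "s d \<le> 1" if "d \<in> {1..D}" for d
  proof -
    show "s d > 0" using bspec[OF n that] S by (simp add: s_def)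
    have "sqrt (real (n d)) \<le> S"
      unfolding S_def using that by (intro member_le_sum) auto
    then show "s d \<le> 1" using S by (simp add: s_def)
  qed
  have s_sum: "(\<Sum>d=1..D. s d) = 1"
    using S unfolding s_def S_def by (simp add: sum_divide_distrib[symmetric])
  have P_d: "fst p \<in> {1..D}" if "p \<in> P" for p using that by (auto simp: P_def)
  have \<sigma>: "0 < \<sigma> p" and \<tau>: "0 < \<tau> p" if "p \<in> P" for p
    using s[OF P_d[OF that]] bspec[OF n P_d[OF that]] by (auto simp: \<sigma>_def \<tau>_def)
  have f_int: "integrable ?L (f Y)" for Y
    unfolding f_def P_def by (rule multilinear_gaussian_variational(1)) (use \<sigma> \<tau> c P_def in auto)
  have f_nonneg: "0 \<le> f Y v" for Y v
    unfolding f_def by (intro mult_nonneg_nonneg prod_nonneg) auto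
  have Z_nonneg: "0 \<le> Z Y" for Y
    unfolding Z_def using f_nonneg by simp
  have Z_eq: "ennreal (Z Y) = (\<integral>\<^sup>+v. ennreal (f Y v) \<partial>?L)" for Y
    unfolding Z_def by (rule nn_integral_eq_integral[symmetric]) (use f_int f_nonneg in auto)
  have Z_meas: "(\<lambda>x. ennreal (Z (\<lambda>k. \<Sum>i\<in>I. x i k))) \<in> borel_measurable N"
    unfolding Z_eq f_def N_def P_def
    by (rule nn_integral_multilinear_gaussian(1)) (use \<tau> I P_def c_def m_def in auto)
  have Z_one: "(\<integral>\<^sup>+x. ennreal (Z (\<lambda>k. \<Sum>i\<in>I. x i k)) \<partial>N) = 1"
    unfolding Z_eq f_def N_def P_def
    by (rule nn_integral_multilinear_gaussian(2)) (use \<tau> I P_def c_def m_def in auto)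
  have Z_meas': "(\<lambda>x. Z (\<lambda>k. \<Sum>i\<in>I. x i k)) \<in> borel_measurable N"
    using borel_measurable_enn2real[OF Z_meas] Z_nonneg by simp
  have Z_int: "has_bochner_integral N (\<lambda>x. Z (\<lambda>k. \<Sum>i\<in>I. x i k)) 1"
    using Z_meas' Z_one Z_nonneg by (intro has_bochner_integral_nn_integral) auto
  interpret N: prob_space N
    unfolding N_def by (intro prob_space_PiM prob_space_std_gauss)
  have W_int: "integrable N W" and W_eq: "integral\<^sup>L N W = C / b"
    using Z_int unfolding W_def by (auto simp: has_bochner_integral_iff N.prob_space)
  have "(\<Prod>d=1..D. 1 + s d) \<le> (\<Prod>d=1..D. exp (s d))"
    using less_imp_le[OF s(1)] by (intro prod_mono) (auto intro!: add_nonneg_nonneg)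
  also have "\<dots> = exp 1"
    using s_sum by (simp add: exp_sum[symmetric])
  finally have prod_le: "(\<Prod>d=1..D. 1 + s d) \<le> 272 / 100"
    using e_less_272 by linarith
  have "(\<Sum>d=1..D. real (n d) * ln (1 + 1 / s d)) \<le> (\<Sum>d=1..D. S\<^sup>2 * (s d * (25 / 36)))"
  proof (rule sum_mono)
    fix d assume d: "d \<in> {1..D}"
    \<comment> \<open>By the choice of \<open>s\<close>, one factor \<open>s d\<close> is absorbed
      by \<open>mult_ln_one_plus_inverse_le\<close> and the other one sums to 1. The fraction 25/36
      is a rational upper bound for \<open>ln 2\<close>.\<close>
    have "real (n d) = (S * s d)\<^sup>2"
      using S by (simp add: s_def)
    then have "real (n d) * ln (1 + 1 / s d) = S\<^sup>2 * (s d * (s d * ln (1 + 1 / s d)))"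
      by (simp add: power2_eq_square algebra_simps)
    also have "\<dots> \<le> S\<^sup>2 * (s d * (25 / 36))"
      using mult_ln_one_plus_inverse_le[OF s[OF d]] ln2_le_25_over_36 s[OF d]
      by (intro mult_left_mono) auto
    finally show "real (n d) * ln (1 + 1 / s d) \<le> S\<^sup>2 * (s d * (25 / 36))" .
  qed
  also have "\<dots> = S\<^sup>2 * (25 / 36)"
    unfolding sum_distrib_left[symmetric] sum_distrib_right[symmetric] s_sum by simp
  finally have ln_le: "(\<Sum>d=1..D. real (n d) * ln (1 + 1 / s d)) \<le> S\<^sup>2 * (25 / 36)" .
  \<comment> \<open>Numerically the factor is about 0.687, below \<open>sqrt 2 / 2\<close>, which is
    about 0.707.\<close>
  have "C \<le> S\<^sup>2 * (1 / 8 * (272 / 100) + 25 / 72)"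
    using mult_left_mono[OF prod_le, of "S\<^sup>2 / 8"] ln_le unfolding C_def c_eq by (simp add: algebra_simps)
  also have "\<dots> \<le> S\<^sup>2 * (7 / 10)"
    by (intro mult_left_mono) auto
  also have "\<dots> \<le> S\<^sup>2 * (sqrt 2 / 2)"
    using real_le_rsqrt[of "7 / 5" 2] by (intro mult_left_mono) (auto simp: power2_eq_square)
  finally have "C / b \<le> S\<^sup>2 * (sqrt 2 / 2) / b"
    using b by (intro divide_right_mono) auto
  also have "\<dots> = sqrt 2 * sqrt m * S"
    using S m by (simp add: b_def power2_eq_square)
  finally have W_le: "integral\<^sup>L N W \<le> sqrt 2 * sqrt m * S" unfolding W_eq .
  have "tensor_inner D n (\<lambda>k. \<Sum>i\<in>I. x i k) (rank_one D n u) \<le> W x"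
    if u: "unit_vectors D n u" for x u
  proof -
    define Y where "Y = (\<lambda>k. \<Sum>i\<in>I. x i k)"
    define \<mu> where "\<mu> p = u (fst p) (snd p)" for p
    have u2: "(\<Sum>j=1..n d. (u d j)\<^sup>2) = 1" if "d \<in> {1..D}" for d
      using u that by (simp add: L2_set_def unit_vectors_def)
    have var: "(\<Sum>k\<in>?K. b * Y k * (\<Prod>d=1..D. \<mu> (d, k d)) - c / 2 * (\<Prod>d=1..D. (\<mu> (d, k d))\<^sup>2 + (\<sigma> (d, k d))\<^sup>2))
        + (\<Sum>p\<in>P. ln (\<sigma> p / \<tau> p) - ((\<mu> p)\<^sup>2 + (\<sigma> p)\<^sup>2) / (2 * (\<tau> p)\<^sup>2) + 1 / 2) \<le> Z Y - 1"
      unfolding Z_def f_def P_def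
      by (rule multilinear_gaussian_variational(2)) (use \<sigma> \<tau> c P_def in auto)
    have inner: "tensor_inner D n Y (rank_one D n u) = (\<Sum>k\<in>?K. Y k * (\<Prod>d=1..D. \<mu> (d, k d)))"
      by (simp add: tensor_inner_def rank_one_def \<mu>_def)
    \<comment> \<open>The sum over multi-indices factors over \<open>d\<close>, and each factor
      depends only on the norm of \<open>u d\<close>.\<close>
    have "(\<Sum>k\<in>?K. \<Prod>d=1..D. (\<mu> (d, k d))\<^sup>2 + (\<sigma> (d, k d))\<^sup>2)
        = (\<Prod>d=1..D. \<Sum>j=1..n d. (\<mu> (d, j))\<^sup>2 + (\<sigma> (d, j))\<^sup>2)"
      unfolding tensor_index_def by (rule prod_sum_PiE[symmetric]) auto
    also have "\<dots> = (\<Prod>d=1..D. 1 + s d)"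
    proof (rule prod.cong)
      fix d assume d: "d \<in> {1..D}"
      show "(\<Sum>j=1..n d. (\<mu> (d, j))\<^sup>2 + (\<sigma> (d, j))\<^sup>2) = 1 + s d"
        using s[OF d] bspec[OF n d] u2[OF d] by (simp add: sum.distrib \<mu>_def \<sigma>_def)
    qed simp
    finally have sq: "(\<Sum>k\<in>?K. \<Prod>d=1..D. (\<mu> (d, k d))\<^sup>2 + (\<sigma> (d, k d))\<^sup>2) = (\<Prod>d=1..D. 1 + s d)" .
    have "(\<Sum>p\<in>P. ln (\<sigma> p / \<tau> p) - ((\<mu> p)\<^sup>2 + (\<sigma> p)\<^sup>2) / (2 * (\<tau> p)\<^sup>2) + 1 / 2)
       = (\<Sum>d=1..D. \<Sum>j=1..n d. ln (\<sigma> (d, j) / \<tau> (d, j)) - ((\<mu> (d, j))\<^sup>2 + (\<sigma> (d, j))\<^sup>2) / (2 * (\<tau> (d, j))\<^sup>2) + 1 / 2)"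
      unfolding P_def by (subst sum.Sigma) auto
    also have "\<dots> = (\<Sum>d=1..D. - (real (n d) * ln (1 + 1 / s d)) / 2)"
    proof (rule sum.cong)
      fix d assume d: "d \<in> {1..D}"
      let ?n = "real (n d)"
      have np: "?n > 0" using bspec[OF n d] by simp
      have "ln (\<sigma> (d, j) / \<tau> (d, j)) = - ln (1 + 1 / s d) / 2" for j
      proof -
        have "\<sigma> (d, j) / \<tau> (d, j) = sqrt (inverse (1 + 1 / s d))"
          unfolding \<sigma>_def \<tau>_def real_sqrt_divide[symmetric] using s[OF d] np by (simp add: field_simps)
        then show ?thesis
          using s[OF d] by (simp add: ln_sqrt ln_inverse add_pos_pos)
      qed
      then have "(\<Sum>j=1..n d. ln (\<sigma> (d, j) / \<tau> (d, j)) - ((\<mu> (d, j))\<^sup>2 + (\<sigma> (d, j))\<^sup>2) / (2 * (\<tau> (d, j))\<^sup>2) + 1 / 2)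
        = (\<Sum>j=1..n d. - ln (1 + 1 / s d) / 2 + 1 / 2 - ((u d j)\<^sup>2 + s d / ?n) * (?n / (2 * (1 + s d))))"
        using s[OF d] np by (intro sum.cong) (auto simp: \<mu>_def \<sigma>_def \<tau>_def field_simps)
      \<comment> \<open>The variance of the reference density matches the mean square
        \<open>(1 + s d) / n d\<close>, so the quadratic part cancels the terms \<open>1 / 2\<close>
        and only the logarithm survives.\<close>
      also have "\<dots> = ?n * (- ln (1 + 1 / s d) / 2 + 1 / 2) - (1 + s d) * (?n / (2 * (1 + s d)))"
        unfolding sum_subtractf sum_distrib_right[symmetric] sum.distrib using u2[OF d] np by (simp add: right_diff_distrib)
      also have "\<dots> = - (?n * ln (1 + 1 / s d)) / 2"
        using s[OF d] by (simp add: field_simps)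
      finally show "(\<Sum>j=1..n d. ln (\<sigma> (d, j) / \<tau> (d, j)) - ((\<mu> (d, j))\<^sup>2 + (\<sigma> (d, j))\<^sup>2) / (2 * (\<tau> (d, j))\<^sup>2) + 1 / 2)
        = - (?n * ln (1 + 1 / s d)) / 2" .
    qed simp
    also have "\<dots> = - (\<Sum>d=1..D. real (n d) * ln (1 + 1 / s d)) / 2"
      by (simp add: sum_negf sum_divide_distrib)
    finally have "b * tensor_inner D n Y (rank_one D n u) - C \<le> Z Y - 1"
      using var unfolding sum_subtractf sum_distrib_left[symmetric] sq C_def inner mult.assoc by simp
    then have "b * tensor_inner D n Y (rank_one D n u) \<le> b * W x"
      using b unfolding W_def Y_def by simp
    then show ?thesis using b by (simp add: Y_def)
  qed
  with W_int W_le show ?thesis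
    using that[of W] unfolding m_def S_def by blast
qed

section \<open>Operator norm, nuclear norm and their duality\<close>

lemma finite_tensor_index: "finite (tensor_index D n)"
  by (simp add: tensor_index_def finite_PiE)

lemma abs_rank_one_le:
  assumes u: "unit_vectors D n u" and k: "k \<in> tensor_index D n"
  shows "\<bar>rank_one D n u k\<bar> \<le> 1"
proof -
  have "\<bar>u d (k d)\<bar> \<le> 1" if d: "d \<in> {1..D}" for d
  proof -
    have kd: "k d \<in> {1..n d}" using k d by (auto simp: tensor_index_def PiE_def Pi_def)
    have "\<bar>u d (k d)\<bar> \<le> L2_set (\<lambda>j. \<bar>u d j\<bar>) {1..n d}"
      using kd by (intro member_le_L2_set[where f = "\<lambda>j. \<bar>u d j\<bar>"]) auto
    also have "\<dots> = 1" using u d by (simp add: unit_vectors_def L2_set_def)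
    finally show ?thesis .
  qed
  then have "(\<Prod>d=1..D. \<bar>u d (k d)\<bar>) \<le> 1"
    by (intro prod_le_1) auto
  then show ?thesis using k by (simp add: rank_one_def abs_prod)
qed

lemma unit_vectors_delta:
  assumes "\<And>d. d \<in> {1..D} \<Longrightarrow> k d \<in> {1..n d}"
  shows "unit_vectors D n (\<lambda>d j. if j = k d then 1 else 0)"
  unfolding unit_vectors_def
proof
  fix d assume d: "d \<in> {1..D}"
  have "(\<Sum>j=1..n d. (if j = k d then 1 else 0 :: real)\<^sup>2) = (\<Sum>j=1..n d. if j = k d then 1 else 0)"
    by (intro sum.cong) auto
  also have "\<dots> = 1" using assms[OF d] by simp
  finally show "L2_set (\<lambda>j. if j = k d then 1 else 0 :: real) {1..n d} = 1"
    by (simp add: L2_set_def)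
qed

text \<open>Negate the first vector; for \<open>D = 0\<close> there would be none. Hence the values
  on rank-one tensors come with both signs.\<close>

lemma rank_one_flip:
  assumes D: "0 < D" and u: "unit_vectors D n u"
  obtains v where "unit_vectors D n v" "\<And>Y. tensor_inner D n Y (rank_one D n v) = - tensor_inner D n Y (rank_one D n u)"
proof
  let ?v = "u(1 := \<lambda>j. - u 1 j)"
  show "unit_vectors D n ?v"
    using u by (auto simp: unit_vectors_def L2_set_def)
  have "(\<Prod>d=1..D. ?v d (k d)) = - (\<Prod>d=1..D. u d (k d))" for k
  proof -
    have "{1..D} = insert 1 {2..D}" using D by auto
    moreover have "(\<Prod>d=2..D. ?v d (k d)) = (\<Prod>d=2..D. u d (k d))"
      by (intro prod.cong) auto
    ultimately show ?thesis by simp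
  qed
  then show "tensor_inner D n Y (rank_one D n ?v) = - tensor_inner D n Y (rank_one D n u)" for Y
    unfolding tensor_inner_def rank_one_def sum_negf[symmetric] by (intro sum.cong) auto
qed

text \<open>The sum of the absolute entries bounds the set, so that its \<open>Sup\<close> is a
  genuine upper bound.\<close>

lemma tensor_inner_rank_one_le_operator_norm:
  assumes "unit_vectors D n u"
  shows "tensor_inner D n Y (rank_one D n u) \<le> operator_norm D n Y"
  unfolding operator_norm_def
proof (rule cSup_upper)
  show "bdd_above {tensor_inner D n Y (rank_one D n u) |u. \<forall>d\<in>{1..D}. L2_set (u d) {1..n d} = 1}"
  proof (rule bdd_aboveI)
    fix t assume "t \<in> {tensor_inner D n Y (rank_one D n u) |u. \<forall>d\<in>{1..D}. L2_set (u d) {1..n d} = 1}"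
    then obtain v where v: "unit_vectors D n v" and t: "t = tensor_inner D n Y (rank_one D n v)"
      by (auto simp: unit_vectors_def)
    have "Y k * rank_one D n v k \<le> \<bar>Y k\<bar>" if "k \<in> tensor_index D n" for k
      using mult_left_mono[OF abs_rank_one_le[OF v that], of "\<bar>Y k\<bar>"]
      by (metis abs_ge_self abs_ge_zero abs_mult mult.right_neutral order_trans)
    then show "t \<le> (\<Sum>k\<in>tensor_index D n. \<bar>Y k\<bar>)"
      unfolding t tensor_inner_def by (intro sum_mono)
  qed
qed (use assms in \<open>auto simp: unit_vectors_def\<close>)

lemma operator_norm_le:
  assumes n: "\<forall>d\<in>{1..D}. n d > 0"
    and le: "\<And>u. unit_vectors D n u \<Longrightarrow> tensor_inner D n Y (rank_one D n u) \<le> r"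
  shows "operator_norm D n Y \<le> r"
  unfolding operator_norm_def
proof (rule cSup_least)
  have "unit_vectors D n (\<lambda>d j. if j = 1 then 1 else 0)"
    using n by (intro unit_vectors_delta) (auto simp: Suc_le_eq)
  then show "{tensor_inner D n Y (rank_one D n u) |u. \<forall>d\<in>{1..D}. L2_set (u d) {1..n d} = 1} \<noteq> {}"
    by (auto simp: unit_vectors_def)
qed (use le in \<open>auto simp: unit_vectors_def\<close>)

text \<open>Coordinate unit vectors pick out one entry, and \<open>rank_one_flip\<close> supplies
  the other sign. Thus the unit ball of the operator norm is bounded and the supremum in
  \<open>nuclear_norm\<close> is finite.\<close>

lemma abs_entry_le_operator_norm:
  assumes D: "0 < D" and k: "k \<in> tensor_index D n"
  shows "\<bar>Y k\<bar> \<le> operator_norm D n Y"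
proof -
  let ?u = "\<lambda>d j. if j = k d then 1 else 0 :: real"
  have u: "unit_vectors D n ?u"
    using k by (intro unit_vectors_delta) (auto simp: tensor_index_def PiE_def Pi_def)
  have "(\<Prod>d=1..D. ?u d (l d)) = (if l = k then 1 else 0)" if l: "l \<in> tensor_index D n" for l
  proof (cases "l = k")
    case False
    then obtain d where "d \<in> {1..D}" "l d \<noteq> k d"
      using PiE_ext[of l "{1..D}" "\<lambda>d. {1..n d}" k] k l by (auto simp: tensor_index_def)
    then show ?thesis using False by (auto intro!: prod_zero)
  qed simp
  then have "tensor_inner D n Y (rank_one D n ?u) = (\<Sum>l\<in>tensor_index D n. if l = k then Y l else 0)"
    unfolding tensor_inner_def rank_one_def by (intro sum.cong) auto
  also have "\<dots> = Y k" using k finite_tensor_index by simp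
  finally have Yk: "tensor_inner D n Y (rank_one D n ?u) = Y k" .
  obtain v where "unit_vectors D n v" "tensor_inner D n Y (rank_one D n v) = - Y k"
    using rank_one_flip[OF D u] Yk by metis
  then show ?thesis
    using tensor_inner_rank_one_le_operator_norm[OF u, of Y] tensor_inner_rank_one_le_operator_norm[of D n v Y] Yk
    by auto
qed

text \<open>A polar set, so that membership needs no finiteness of the supremum in \<open>nuclear_norm\<close>.\<close>

definition nuclear_ball :: "nat \<Rightarrow> (nat \<Rightarrow> nat) \<Rightarrow> real \<Rightarrow> ((nat \<Rightarrow> nat) \<Rightarrow> real) set" where
  "nuclear_ball D n r =
     {X \<in> tensors D n. \<forall>Y\<in>tensors D n. operator_norm D n Y \<le> 1 \<longrightarrow> tensor_inner D n X Y \<le> r}"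

text \<open>A tensor with the single nonzero entry 1 or -1 has operator norm at most 1. The
  resulting boundedness gives the finite net and the integrability of the error.\<close>

lemma abs_entry_le_nuclear_ball:
  assumes n: "\<forall>d\<in>{1..D}. n d > 0" and X: "X \<in> nuclear_ball D n r" and k: "k \<in> tensor_index D n"
  shows "\<bar>X k\<bar> \<le> r"
proof -
  have "e * X k \<le> r" if e: "\<bar>e\<bar> = 1" for e :: real
  proof -
    let ?Y = "\<lambda>l\<in>tensor_index D n. if l = k then e else 0"
    have inner: "tensor_inner D n Z ?Y = e * Z k" for Z
      using k finite_tensor_index[of D n] unfolding tensor_inner_def
      by (subst sum.cong[OF refl, of _ _ "\<lambda>l. if l = k then e * Z k else 0"]) auto
    have "operator_norm D n ?Y \<le> 1"
    proof (rule operator_norm_le[OF n])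
      fix u assume u: "unit_vectors D n u"
      have "tensor_inner D n ?Y (rank_one D n u) = e * rank_one D n u k"
        using inner[of "rank_one D n u"] by (simp add: tensor_inner_def mult.commute)
      also have "\<dots> \<le> 1"
        using abs_rank_one_le[OF u k] e by (metis abs_ge_self abs_mult mult_1 order_trans)
      finally show "tensor_inner D n ?Y (rank_one D n u) \<le> 1" .
    qed
    then have "tensor_inner D n X ?Y \<le> r"
      using X by (auto simp: nuclear_ball_def tensors_def)
    then show ?thesis by (simp add: inner)
  qed
  from this[of 1] this[of "- 1"] show ?thesis by simp
qed

lemma tensor_inner_le_nuclear_norm:
  assumes D: "0 < D" and Y: "Y \<in> tensors D n" "operator_norm D n Y \<le> 1"
  shows "tensor_inner D n X Y \<le> nuclear_norm D n X"
  unfolding nuclear_norm_def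
proof (rule cSup_upper)
  show "bdd_above {tensor_inner D n X Y |Y. Y \<in> tensors D n \<and> operator_norm D n Y \<le> 1}"
  proof (rule bdd_aboveI)
    fix t assume "t \<in> {tensor_inner D n X Y |Y. Y \<in> tensors D n \<and> operator_norm D n Y \<le> 1}"
    then obtain Z where Z: "operator_norm D n Z \<le> 1" and t: "t = tensor_inner D n X Z" by auto
    have "X k * Z k \<le> \<bar>X k\<bar>" if k: "k \<in> tensor_index D n" for k
      using mult_left_mono[OF order_trans[OF abs_entry_le_operator_norm[OF D k] Z], of "\<bar>X k\<bar>"]
      by (metis abs_ge_self abs_ge_zero abs_mult mult.right_neutral order_trans)
    then show "t \<le> (\<Sum>k\<in>tensor_index D n. \<bar>X k\<bar>)"
      unfolding t tensor_inner_def by (intro sum_mono)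
  qed
qed (use Y in auto)

lemma nuclear_norm_nonneg:
  assumes D: "0 < D" and n: "\<forall>d\<in>{1..D}. n d > 0"
  shows "0 \<le> nuclear_norm D n X"
proof -
  let ?Z = "\<lambda>k\<in>tensor_index D n. 0 :: real"
  have "operator_norm D n ?Z \<le> 1"
    by (rule operator_norm_le[OF n]) (simp add: tensor_inner_def)
  then have "tensor_inner D n X ?Z \<le> nuclear_norm D n X"
    by (intro tensor_inner_le_nuclear_norm D) (auto simp: tensors_def)
  then show ?thesis by (simp add: tensor_inner_def)
qed

text \<open>The triangle inequality by duality: \<open>Y\<close> is tested against \<open>X'\<close>
  and its negative, again of operator norm at most 1, against \<open>X\<close>.\<close>

lemma tensor_diff_in_nuclear_ball:
  assumes D: "0 < D" and n: "\<forall>d\<in>{1..D}. n d > 0" and le: "nuclear_norm D n X' \<le> nuclear_norm D n X"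
  shows "tensor_diff D n X' X \<in> nuclear_ball D n (2 * nuclear_norm D n X)"
  unfolding nuclear_ball_def
proof (intro CollectI conjI ballI impI)
  show "tensor_diff D n X' X \<in> tensors D n" by (auto simp: tensor_diff_def tensors_def)
  fix Y assume Y: "Y \<in> tensors D n" "operator_norm D n Y \<le> 1"
  let ?Z = "\<lambda>k\<in>tensor_index D n. - Y k"
  have inner: "tensor_inner D n ?Z V = - tensor_inner D n Y V" for V
    by (simp add: tensor_inner_def sum_negf)
  have "operator_norm D n ?Z \<le> 1"
  proof (rule operator_norm_le[OF n])
    fix u assume "unit_vectors D n u"
    then obtain v where v: "unit_vectors D n v" "tensor_inner D n Y (rank_one D n v) = - tensor_inner D n Y (rank_one D n u)"
      using rank_one_flip[OF D] by metis
    then show "tensor_inner D n ?Z (rank_one D n u) \<le> 1"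
      using tensor_inner_rank_one_le_operator_norm[OF v(1), of Y] Y(2) unfolding inner by linarith
  qed
  then have "tensor_inner D n X ?Z \<le> nuclear_norm D n X"
    by (intro tensor_inner_le_nuclear_norm D) (auto simp: tensors_def)
  moreover have "tensor_inner D n X' Y \<le> nuclear_norm D n X"
    using tensor_inner_le_nuclear_norm[OF D Y, of X'] le by linarith
  moreover have "tensor_inner D n (tensor_diff D n X' X) Y = tensor_inner D n X' Y + tensor_inner D n X ?Z"
    by (simp add: tensor_inner_def tensor_diff_def sum.distrib[symmetric] left_diff_distrib)
  ultimately show "tensor_inner D n (tensor_diff D n X' X) Y \<le> 2 * nuclear_norm D n X" by linarith
qed

text \<open>Duality of the norms by scaling \<open>Y\<close>, stated for any bound \<open>w\<close>
  on rank-one tensors, so that the majorant of the operator norm can be inserted.\<close>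

lemma tensor_inner_nuclear_ball_le:
  assumes D: "0 < D" and n: "\<forall>d\<in>{1..D}. n d > 0" and X: "X \<in> nuclear_ball D n r" and r: "0 \<le> r"
    and w: "\<And>u. unit_vectors D n u \<Longrightarrow> tensor_inner D n Y (rank_one D n u) \<le> w"
  shows "tensor_inner D n X Y \<le> r * w"
proof -
  have w0: "0 \<le> w"
  proof -
    have u: "unit_vectors D n (\<lambda>d j. if j = 1 then 1 else 0)"
      using n by (intro unit_vectors_delta) (auto simp: Suc_le_eq)
    obtain v where "unit_vectors D n v"
      "tensor_inner D n Y (rank_one D n v) = - tensor_inner D n Y (rank_one D n (\<lambda>d j. if j = 1 then 1 else 0))"
      using rank_one_flip[OF D u] by metis
    then show ?thesis using w[OF u] w[of v] by linarith
  qed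
  \<comment> \<open>Scaling by \<open>w + e\<close> rather than \<open>w\<close> covers the case
    \<open>w = 0\<close>.\<close>
  have le: "tensor_inner D n X Y \<le> r * (w + e)" if e: "0 < e" for e
  proof -
    let ?Y = "\<lambda>k\<in>tensor_index D n. Y k / (w + e)"
    have "operator_norm D n ?Y \<le> 1"
    proof (rule operator_norm_le[OF n])
      fix u assume "unit_vectors D n u"
      moreover have "tensor_inner D n ?Y (rank_one D n u) = tensor_inner D n Y (rank_one D n u) / (w + e)"
        by (simp add: tensor_inner_def sum_divide_distrib)
      ultimately show "tensor_inner D n ?Y (rank_one D n u) \<le> 1"
        using w[of u] w0 e by (simp add: divide_le_eq)
    qed
    then have "tensor_inner D n X ?Y \<le> r"
      using X by (auto simp: nuclear_ball_def tensors_def)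
    moreover have "tensor_inner D n X ?Y = tensor_inner D n X Y / (w + e)"
      by (simp add: tensor_inner_def sum_divide_distrib)
    ultimately show ?thesis using w0 e by (simp add: divide_le_eq)
  qed
  show ?thesis
  proof (rule field_le_epsilon)
    fix e :: real assume e: "0 < e"
    have "r * (w + e / (r + 1)) \<le> r * w + e"
      using r e by (simp add: field_simps)
    then show "tensor_inner D n X Y \<le> r * w + e"
      using le[of "e / (r + 1)"] e r by simp
  qed
qed

section \<open>Finite nets and the kernel of the Gaussian measurements\<close>

text \<open>Rounding entries down to multiples of \<open>e\<close> yields finitely many patterns.
  One representative per pattern is chosen inside \<open>T\<close>, so that bounds valid on
  \<open>T\<close> hold on the net.\<close>

lemma finite_net_of_bounded_functions:
  fixes T :: "('k \<Rightarrow> real) set"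
  assumes K: "finite K" and T: "\<And>u k. u \<in> T \<Longrightarrow> k \<in> K \<Longrightarrow> \<bar>u k\<bar> \<le> r" and e: "0 < e"
  obtains F where "finite F" "F \<subseteq> T" "\<And>u. u \<in> T \<Longrightarrow> \<exists>v\<in>F. \<forall>k\<in>K. \<bar>u k - v k\<bar> \<le> e"
proof
  define g where "g u = (\<lambda>k\<in>K. \<lfloor>u k / e\<rfloor>)" for u :: "'k \<Rightarrow> real"
  have "g ` T \<subseteq> (\<Pi>\<^sub>E k\<in>K. {\<lfloor>- r / e\<rfloor>..\<lfloor>r / e\<rfloor>})"
  proof safe
    fix u k assume u: "u \<in> T" and k: "k \<in> K"
    have "- r / e \<le> u k / e" "u k / e \<le> r / e"
      using T[OF u k] e by (intro divide_right_mono; simp)+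
    then show "g u k \<in> {\<lfloor>- r / e\<rfloor>..\<lfloor>r / e\<rfloor>}"
      using k unfolding g_def by (auto intro!: floor_mono)
  qed (auto simp: g_def)
  then have fin: "finite (g ` T)"
    by (rule finite_subset) (intro finite_PiE K finite_atLeastAtMost_int)
  let ?F = "inv_into T g ` g ` T"
  show "finite ?F" using fin by simp
  show "?F \<subseteq> T" by (auto intro: inv_into_into)
  fix u assume u: "u \<in> T"
  let ?v = "inv_into T g (g u)"
  have v: "g ?v = g u" by (rule f_inv_into_f[OF imageI[OF u]])
  have "\<bar>u k - ?v k\<bar> \<le> e" if "k \<in> K" for k
  proof -
    have "\<lfloor>u k / e\<rfloor> = \<lfloor>?v k / e\<rfloor>"
      using fun_cong[OF v, of k] that by (simp add: g_def)
    then have "\<bar>u k / e - ?v k / e\<bar> \<le> 1" by linarith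
    then show ?thesis using e by (simp add: diff_divide_distrib[symmetric])
  qed
  then show "\<exists>v\<in>?F. \<forall>k\<in>K. \<bar>u k - v k\<bar> \<le> e" using u by blast
qed

lemma distr_standard_gaussian_tensor:
  assumes M: "prob_space M" and G: "standard_gaussian_tensor D n M G" and K: "tensor_index D n \<noteq> {}"
  shows "distr M (Pi\<^sub>M (tensor_index D n) (\<lambda>_. borel)) G = std_gauss (tensor_index D n)"
proof -
  interpret prob_space M by fact
  let ?K = "tensor_index D n"
  have Gm: "G \<in> measurable M (Pi\<^sub>M ?K (\<lambda>_. borel))"
    and indep: "indep_vars (\<lambda>_. borel) (\<lambda>k \<omega>. G \<omega> k) ?K"
    and dist: "\<And>k. k \<in> ?K \<Longrightarrow> distributed M lborel (\<lambda>\<omega>. G \<omega> k) std_normal_density"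
    using G by (auto simp: standard_gaussian_tensor_def)
  have rv: "random_variable borel (\<lambda>\<omega>. G \<omega> k)" if "k \<in> ?K" for k
    using indep that by (auto simp: indep_vars_def)
  have "distr M (Pi\<^sub>M ?K (\<lambda>_. borel)) G = distr M (Pi\<^sub>M ?K (\<lambda>_. borel)) (\<lambda>\<omega>. \<lambda>k\<in>?K. G \<omega> k)"
    using measurable_space[OF Gm]
    by (intro distr_cong) (auto simp: space_PiM PiE_def extensional_restrict)
  also have "\<dots> = Pi\<^sub>M ?K (\<lambda>k. distr M borel (\<lambda>\<omega>. G \<omega> k))"
    using indep by (subst (asm) indep_vars_iff_distr_eq_PiM'[OF K]) (auto intro: rv)
  also have "\<dots> = std_gauss ?K"
    unfolding std_gauss_def
  proof (intro PiM_cong refl)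
    fix k assume k: "k \<in> ?K"
    have "distr M borel (\<lambda>\<omega>. G \<omega> k) = distr M lborel (\<lambda>\<omega>. G \<omega> k)"
      by (rule distr_cong) auto
    then show "distr M borel (\<lambda>\<omega>. G \<omega> k) = density lborel (\<lambda>x. ennreal (std_normal_density x))"
      using distributed_distr_eq_density[OF dist[OF k]] by simp
  qed
  finally show ?thesis .
qed

lemma L2_set_le_add_of_abs_diff_le:
  assumes "finite K" "\<And>k. k \<in> K \<Longrightarrow> \<bar>u k - v k\<bar> \<le> e"
  shows "L2_set u K \<le> L2_set v K + real (card K) * e"
proof -
  have "L2_set u K \<le> L2_set v K + L2_set (\<lambda>k. u k - v k) K"
    using L2_set_triangle_ineq[of v "\<lambda>k. u k - v k" K] by simp
  also have "L2_set (\<lambda>k. u k - v k) K \<le> (\<Sum>k\<in>K. \<bar>u k - v k\<bar>)"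
    by (rule L2_set_le_sum_abs)
  also have "\<dots> \<le> real (card K) * e"
    using assms by (intro sum_bounded_above) auto
  finally show ?thesis by simp
qed

text \<open>The maxima are taken over a finite net of \<open>nuclear_ball D n r\<close>, which avoids questions of
  measurability; the error \<open>e\<close> comes from its mesh.\<close>

lemma gaussian_kernel_bound:
  fixes I :: "'i set" and D :: nat and n :: "nat \<Rightarrow> nat"
  defines "N \<equiv> Pi\<^sub>M I (\<lambda>_. std_gauss (tensor_index D n))"
  assumes D: "0 < D" and n: "\<forall>d\<in>{1..D}. n d > 0" and I: "finite I" "I \<noteq> {}" and r: "0 \<le> r" and e: "0 < e"
  obtains f where "integrable N f"
    "integral\<^sup>L N f \<le> 2 * r * (sqrt 2 * sqrt (real (card I)) * (\<Sum>d=1..D. sqrt (real (n d)))) + e"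
    "\<And>x h. h \<in> nuclear_ball D n r \<Longrightarrow> \<forall>i\<in>I. tensor_inner D n (x i) h = 0 \<Longrightarrow>
       real (card I) * sqrt (2 / pi) * frobenius_norm D n h \<le> f x"
proof -
  let ?K = "tensor_index D n"
  let ?m = "real (card I)"
  interpret \<gamma>: prob_space "std_gauss ?K" by (rule prob_space_std_gauss)
  interpret N: prob_space N
    unfolding N_def by (intro prob_space_PiM prob_space_std_gauss)
  have K: "finite ?K" by (rule finite_tensor_index)
  have frob: "frobenius_norm D n h = L2_set h ?K" for h
    by (simp add: frobenius_norm_def tensor_inner_def L2_set_def power2_eq_square)
  have entry: "integrable N (\<lambda>x. x i k)" if "i \<in> I" "k \<in> ?K" for i k
    unfolding N_def by (rule integrable_PiM_component[where f = "\<lambda>g. g k"])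
      (use that in \<open>auto intro: prob_space_std_gauss integrable_std_gauss_component\<close>)
  define H where "H x = (\<Sum>i\<in>I. \<Sum>k\<in>?K. \<bar>x i k\<bar>)" for x :: "'i \<Rightarrow> (nat \<Rightarrow> nat) \<Rightarrow> real"
  \<comment> \<open>The mean of the factor that multiplies the mesh in \<open>f\<close> below; the
    mesh \<open>\<delta>\<close> is chosen to make this error at most \<open>e\<close>.\<close>
  define L where "L = ?m * sqrt (2 / pi) * real (card ?K) + integral\<^sup>L N H"
  have H: "integrable N H"
    unfolding H_def using entry by (intro Bochner_Integration.integrable_sum integrable_abs)
  have L: "0 \<le> L"
    unfolding L_def by (intro add_nonneg_nonneg mult_nonneg_nonneg Bochner_Integration.integral_nonneg)
      (auto simp: H_def intro!: sum_nonneg)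
  define \<delta> where "\<delta> = e / (L + 1)"
  have \<delta>: "0 < \<delta>" "\<delta> * L \<le> e"
    using L e by (auto simp: \<delta>_def field_simps)
  obtain F where F: "finite F" "F \<subseteq> nuclear_ball D n r"
    and net: "\<And>u. u \<in> nuclear_ball D n r \<Longrightarrow> \<exists>v\<in>F. \<forall>k\<in>?K. \<bar>u k - v k\<bar> \<le> \<delta>"
    using finite_net_of_bounded_functions[of ?K "nuclear_ball D n r" r \<delta>, OF K _ \<delta>(1)]
      abs_entry_le_nuclear_ball[OF n] by metis
  \<comment> \<open>The zero tensor shows that the ball, and with it the net, is nonempty, as the
    maxima require.\<close>
  have "(\<lambda>k\<in>?K. 0) \<in> nuclear_ball D n r"
    using r by (auto simp: nuclear_ball_def tensors_def tensor_inner_def)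
  then have "F \<noteq> {}" using net by blast
  note F = F this
  define a where "a u g = (\<Sum>k\<in>?K. u k * g k)" for u g :: "(nat \<Rightarrow> nat) \<Rightarrow> real"
  have a_inner: "a u g = tensor_inner D n g u" for u g
    by (simp add: a_def tensor_inner_def mult.commute)
  have a_int: "integrable (std_gauss ?K) (a u)" for u
    unfolding a_def
    by (intro Bochner_Integration.integrable_sum Bochner_Integration.integrable_mult_right integrable_std_gauss_component)
  have a_abs: "\<gamma>.expectation (\<lambda>g. \<bar>a u g\<bar>) = sqrt (2 / pi) * L2_set u ?K" for u
    unfolding a_def by (rule integral_abs_std_gauss_linear[OF K])
  have sym: "\<gamma>.expectation (\<lambda>g. MAX u\<in>F. c u - 2 * a u g) = \<gamma>.expectation (\<lambda>g. MAX u\<in>F. c u + 2 * a u g)" for c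
  proof -
    have "a u (\<lambda>k\<in>?K. - g k) = - a u g" for u g by (simp add: a_def sum_negf)
    moreover have "(\<lambda>g. MAX u\<in>F. c u + 2 * a u g) \<in> borel_measurable (std_gauss ?K)"
      using a_int F by (intro borel_measurable_integrable integrable_MAX) auto
    ultimately show ?thesis
      using integral_std_gauss_uminus[OF K, of "\<lambda>g. MAX u\<in>F. c u + 2 * a u g"] by simp
  qed
  \<comment> \<open>The summand \<open>0\<close> is the function \<open>c\<close> of
    \<open>expectation_MAX_symmetrization_PiM\<close>.\<close>
  define \<Phi> where "\<Phi> x = (MAX u\<in>F. 0 + (\<Sum>i\<in>I. \<gamma>.expectation (\<lambda>g. \<bar>a u g\<bar>) - \<bar>a u (x i)\<bar>))"
    for x :: "'i \<Rightarrow> (nat \<Rightarrow> nat) \<Rightarrow> real"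
  define \<Psi> where "\<Psi> x = (MAX u\<in>F. 0 + (\<Sum>i\<in>I. 2 * a u (x i)))" for x :: "'i \<Rightarrow> (nat \<Rightarrow> nat) \<Rightarrow> real"
  have a_comp: "integrable N (\<lambda>x. a u (x i))" if "i \<in> I" for u i
    unfolding N_def using that a_int by (intro integrable_PiM_component prob_space_std_gauss)
  have \<Phi>_int: "integrable N \<Phi>" and \<Psi>_int: "integrable N \<Psi>"
    unfolding \<Phi>_def \<Psi>_def using F a_comp
    by (intro integrable_MAX Bochner_Integration.integrable_add Bochner_Integration.integrable_sum
        Bochner_Integration.integrable_diff integrable_abs Bochner_Integration.integrable_mult_right
        N.integrable_const; simp)+
  have \<Phi>_le: "integral\<^sup>L N \<Phi> \<le> integral\<^sup>L N \<Psi>"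
    unfolding \<Phi>_def \<Psi>_def N_def
    by (rule \<gamma>.expectation_MAX_symmetrization_PiM[OF F(1,3) a_int sym I(1)])
  obtain W where W: "integrable N W"
    "integral\<^sup>L N W \<le> sqrt 2 * sqrt (real (card I)) * (\<Sum>d=1..D. sqrt (real (n d)))"
    "\<And>x u. unit_vectors D n u \<Longrightarrow>
       tensor_inner D n (\<lambda>k. \<Sum>i\<in>I. x i k) (rank_one D n u) \<le> W x"
    using gaussian_operator_norm_bound[OF D n I] unfolding N_def by blast
  have "integral\<^sup>L N \<Psi> \<le> (\<integral>x. 2 * r * W x \<partial>N)"
  proof (rule integral_mono)
    fix x
    have "(\<Sum>i\<in>I. 2 * a u (x i)) \<le> 2 * r * W x" if u: "u \<in> F" for u
    proof -
      \<comment> \<open>After the contraction only the sum of the measurement tensors enters, and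
        duality bounds its product with \<open>u\<close>.\<close>
      have "(\<Sum>i\<in>I. a u (x i)) = tensor_inner D n u (\<lambda>k. \<Sum>i\<in>I. x i k)"
        unfolding a_def tensor_inner_def sum_distrib_left by (rule sum.swap)
      also have "\<dots> \<le> r * W x"
        using W(3) u F by (intro tensor_inner_nuclear_ball_le[OF D n _ r]) auto
      finally show ?thesis by (simp add: sum_distrib_left[symmetric])
    qed
    then show "\<Psi> x \<le> 2 * r * W x"
      unfolding \<Psi>_def using F by (intro Max.boundedI) auto
  qed (use \<Psi>_int W(1) in auto)
  also have "\<dots> \<le> 2 * r * (sqrt 2 * sqrt (real (card I)) * (\<Sum>d=1..D. sqrt (real (n d))))"
    using W(2) r by (auto intro!: mult_left_mono)
  finally have \<Psi>_le: "integral\<^sup>L N \<Psi> \<le> 2 * r * (sqrt 2 * sqrt (real (card I)) * (\<Sum>d=1..D. sqrt (real (n d))))" .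
  define f where "f x = \<Phi> x + \<delta> * (?m * sqrt (2 / pi) * real (card ?K) + H x)" for x
  show ?thesis
  proof (rule that[of f])
    show "integrable N f" unfolding f_def using \<Phi>_int H by simp
    have "integral\<^sup>L N f = integral\<^sup>L N \<Phi> + \<delta> * L"
      unfolding f_def L_def using \<Phi>_int H by (simp add: N.prob_space)
    then show "integral\<^sup>L N f \<le> 2 * r * (sqrt 2 * sqrt (real (card I)) * (\<Sum>d=1..D. sqrt (real (n d)))) + e"
      using \<Phi>_le \<Psi>_le \<delta> by linarith
  next
    fix x h
    assume h: "h \<in> nuclear_ball D n r" and ker: "\<forall>i\<in>I. tensor_inner D n (x i) h = 0"
    obtain v where v: "v \<in> F" and hv: "\<And>k. k \<in> ?K \<Longrightarrow> \<bar>h k - v k\<bar> \<le> \<delta>"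
      using net[OF h] by blast
    \<comment> \<open>The measurements vanish on \<open>h\<close>, so on the nearby net point
      \<open>v\<close> they are of the order of the mesh.\<close>
    have "(\<Sum>i\<in>I. \<bar>a v (x i)\<bar>) \<le> (\<Sum>i\<in>I. \<delta> * (\<Sum>k\<in>?K. \<bar>x i k\<bar>))"
    proof (rule sum_mono)
      fix i assume i: "i \<in> I"
      have "a v (x i) = - (a h (x i) - a v (x i))"
        using ker i by (simp add: a_inner)
      also have "\<dots> = - (\<Sum>k\<in>?K. (h k - v k) * x i k)"
        by (simp add: a_def sum_subtractf left_diff_distrib)
      finally have "\<bar>a v (x i)\<bar> = \<bar>\<Sum>k\<in>?K. (h k - v k) * x i k\<bar>" by simp
      also have "\<dots> \<le> (\<Sum>k\<in>?K. \<bar>(h k - v k) * x i k\<bar>)" by (rule sum_abs)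
      also have "\<dots> \<le> (\<Sum>k\<in>?K. \<delta> * \<bar>x i k\<bar>)"
        unfolding abs_mult using hv by (intro sum_mono mult_right_mono) auto
      finally show "\<bar>a v (x i)\<bar> \<le> \<delta> * (\<Sum>k\<in>?K. \<bar>x i k\<bar>)"
        by (simp add: sum_distrib_left)
    qed
    then have 1: "(\<Sum>i\<in>I. \<bar>a v (x i)\<bar>) \<le> \<delta> * H x"
      by (simp add: H_def sum_distrib_left)
    have 2: "?m * (sqrt (2 / pi) * L2_set h ?K) \<le> ?m * (sqrt (2 / pi) * (L2_set v ?K + real (card ?K) * \<delta>))"
      using L2_set_le_add_of_abs_diff_le[OF K hv] by (intro mult_left_mono) auto
    have "0 + (\<Sum>i\<in>I. \<gamma>.expectation (\<lambda>g. \<bar>a v g\<bar>) - \<bar>a v (x i)\<bar>) \<le> \<Phi> x"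
      unfolding \<Phi>_def using v F by (intro Max_ge) auto
    then have 3: "?m * (sqrt (2 / pi) * L2_set v ?K) - (\<Sum>i\<in>I. \<bar>a v (x i)\<bar>) \<le> \<Phi> x"
      by (simp add: sum_subtractf a_abs)
    show "?m * sqrt (2 / pi) * frobenius_norm D n h \<le> f x"
      using 1 2 3 unfolding f_def frob by (simp add: algebra_simps)
  qed
qed

section \<open>Transfer to the given probability space and the final constant\<close>

theorem theorem3p1:
  fixes D m :: nat
    and n :: "nat \<Rightarrow> nat"
    and X :: "(nat \<Rightarrow> nat) \<Rightarrow> real"
    and M :: "'a measure"
    and G :: "nat \<Rightarrow> 'a \<Rightarrow> (nat \<Rightarrow> nat) \<Rightarrow> real"
    and y :: "nat \<Rightarrow> 'a \<Rightarrow> real"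
    and Xhat :: "'a \<Rightarrow> (nat \<Rightarrow> nat) \<Rightarrow> real"
  assumes "D > 0" and "\<forall>d\<in>{1..D}. n d > 0" and "m > 0"
    and "X \<in> tensors D n"
    and "prob_space M"
    and "prob_space.indep_vars M (\<lambda>_. PiM (tensor_index D n) (\<lambda>_. borel)) G {1..m}"
    and "\<forall>i\<in>{1..m}. standard_gaussian_tensor D n M (G i)"
    and "\<forall>i\<in>{1..m}. \<forall>\<omega>\<in>space M. y i \<omega> = tensor_inner D n (G i \<omega>) X"
    and "\<forall>\<omega>\<in>space M. is_nuclear_solution D n m (\<lambda>i. G i \<omega>) (\<lambda>i. y i \<omega>) (Xhat \<omega>)"
    and "(\<lambda>\<omega>. frobenius_norm D n (tensor_diff D n (Xhat \<omega>) X)) \<in> borel_measurable M"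
  shows "integrable M (\<lambda>\<omega>. frobenius_norm D n (tensor_diff D n (Xhat \<omega>) X))
    \<and> prob_space.expectation M (\<lambda>\<omega>. frobenius_norm D n (tensor_diff D n (Xhat \<omega>) X))
        \<le> 4 * sqrt pi * ((\<Sum>d=1..D. sqrt (real (n d))) / sqrt (real m)) * nuclear_norm D n X"
proof -
  interpret prob_space M by fact
  let ?K = "tensor_index D n"
  let ?I = "{1..m}"
  let ?B = "Pi\<^sub>M ?K (\<lambda>_. borel :: real measure)"
  define N where "N = Pi\<^sub>M ?I (\<lambda>_. std_gauss ?K)"
  define r where "r = 2 * nuclear_norm D n X"
  define S where "S = (\<Sum>d=1..D. sqrt (real (n d)))"
  define h where "h \<omega> = tensor_diff D n (Xhat \<omega>) X" for \<omega>
  \<comment> \<open>All measurements as one random point of the product space; the restriction makes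
    it extensional.\<close>
  define x where "x \<omega> = (\<lambda>i\<in>?I. G i \<omega>)" for \<omega>
  note D = \<open>D > 0\<close> and n = \<open>\<forall>d\<in>{1..D}. n d > 0\<close>
  have I: "finite ?I" "?I \<noteq> {}" using \<open>m > 0\<close> by auto
  have r: "0 \<le> r" using nuclear_norm_nonneg[OF D n] by (simp add: r_def)
  have K: "?K \<noteq> {}" using n by (auto simp: tensor_index_def PiE_eq_empty_iff Suc_le_eq)
  have G: "G i \<in> measurable M ?B" if "i \<in> ?I" for i
    using assms(7) that by (auto simp: standard_gaussian_tensor_def)
  have x: "x \<in> measurable M (Pi\<^sub>M ?I (\<lambda>_. ?B))"
    unfolding x_def using G by (intro measurable_restrict)
  have "distr M (Pi\<^sub>M ?I (\<lambda>_. ?B)) x = Pi\<^sub>M ?I (\<lambda>i. distr M ?B (G i))"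
    using assms(6) G unfolding x_def by (subst (asm) indep_vars_iff_distr_eq_PiM'[OF I(2)]) auto
  also have "\<dots> = N"
    unfolding N_def using distr_standard_gaussian_tensor[OF \<open>prob_space M\<close> _ K] assms(7)
    by (intro PiM_cong) auto
  finally have distr: "distr M (Pi\<^sub>M ?I (\<lambda>_. ?B)) x = N" .
  have h_props: "h \<omega> \<in> nuclear_ball D n r" "\<forall>i\<in>?I. tensor_inner D n (x \<omega> i) (h \<omega>) = 0"
    if \<omega>: "\<omega> \<in> space M" for \<omega>
  proof -
    have sol: "is_arg_min (nuclear_norm D n)
       (\<lambda>X'. X' \<in> tensors D n \<and> (\<forall>i\<in>?I. tensor_inner D n (G i \<omega>) X' = y i \<omega>)) (Xhat \<omega>)"
      using assms(9) \<omega> by (simp add: is_nuclear_solution_def)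
    \<comment> \<open>The tensor \<open>X\<close> is itself feasible.\<close>
    then have "nuclear_norm D n (Xhat \<omega>) \<le> nuclear_norm D n X"
      using assms(4,8) \<omega> by (auto simp: is_arg_min_def not_less)
    then show "h \<omega> \<in> nuclear_ball D n r"
      unfolding h_def r_def by (rule tensor_diff_in_nuclear_ball[OF D n])
    have "tensor_inner D n (x \<omega> i) (h \<omega>) = tensor_inner D n (G i \<omega>) (Xhat \<omega>) - tensor_inner D n (G i \<omega>) X"
      if "i \<in> ?I" for i
      using that by (simp add: x_def h_def tensor_inner_def tensor_diff_def sum_subtractf right_diff_distrib)
    then show "\<forall>i\<in>?I. tensor_inner D n (x \<omega> i) (h \<omega>) = 0"
      using sol assms(8) \<omega> by (auto simp: is_arg_min_def)
  qed
  let ?h = "\<lambda>\<omega>. frobenius_norm D n (h \<omega>)"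
  \<comment> \<open>The error lies in a ball with bounded entries, so its Frobenius norm is bounded
    by a constant.\<close>
  have int: "integrable M ?h"
  proof (rule integrable_const_bound)
    show "?h \<in> borel_measurable M" using assms(10) by (simp add: h_def)
    have "frobenius_norm D n (h \<omega>) \<le> sqrt (\<Sum>k\<in>?K. r * r)" if "\<omega> \<in> space M" for \<omega>
      unfolding frobenius_norm_def tensor_inner_def
      using abs_entry_le_nuclear_ball[OF n h_props(1)[OF that]]
      by (intro real_sqrt_le_mono sum_mono) (metis abs_ge_zero abs_mult abs_mult_self mult_mono r)
    moreover have "0 \<le> frobenius_norm D n (h \<omega>)" for \<omega>
      by (simp add: frobenius_norm_def tensor_inner_def sum_nonneg)
    ultimately show "AE \<omega> in M. norm (?h \<omega>) \<le> sqrt (\<Sum>k\<in>?K. r * r)"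
      by (intro AE_I2) simp
  qed
  \<comment> \<open>The majorant \<open>f\<close> depends on the mesh, hence the slack
    \<open>e\<close>.\<close>
  have "real m * sqrt (2 / pi) * expectation ?h \<le> 2 * r * (sqrt 2 * sqrt (real m) * S)"
  proof (rule field_le_epsilon)
    fix e :: real assume "0 < e"
    then obtain f where f: "integrable N f" "integral\<^sup>L N f \<le> 2 * r * (sqrt 2 * sqrt (real m) * S) + e"
      and le: "\<And>x h. h \<in> nuclear_ball D n r \<Longrightarrow> \<forall>i\<in>?I. tensor_inner D n (x i) h = 0 \<Longrightarrow>
        real m * sqrt (2 / pi) * frobenius_norm D n h \<le> f x"
      using gaussian_kernel_bound[OF D n I r] unfolding N_def S_def by (metis card_atLeastAtMost diff_Suc_1)
    have fm: "f \<in> borel_measurable (Pi\<^sub>M ?I (\<lambda>_. ?B))"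
      using borel_measurable_integrable[OF f(1)] by (simp add: distr[symmetric])
    have f': "integrable M (\<lambda>\<omega>. f (x \<omega>))" "expectation (\<lambda>\<omega>. f (x \<omega>)) = integral\<^sup>L N f"
      using f(1) unfolding distr[symmetric] integrable_distr_eq[OF x fm] integral_distr[OF x fm] by auto
    have "real m * sqrt (2 / pi) * expectation ?h = expectation (\<lambda>\<omega>. real m * sqrt (2 / pi) * ?h \<omega>)"
      by simp
    also have "\<dots> \<le> expectation (\<lambda>\<omega>. f (x \<omega>))"
      using int f'(1) le h_props by (intro integral_mono) auto
    finally show "real m * sqrt (2 / pi) * expectation ?h \<le> 2 * r * (sqrt 2 * sqrt (real m) * S) + e"
      using f(2) f'(2) by simp
  qed
  \<comment> \<open>Here \<open>r\<close> is twice the nuclear norm, and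
    \<open>sqrt 2 / sqrt (2 / pi) = sqrt pi\<close>.\<close>
  also have "\<dots> = real m * sqrt (2 / pi) * (4 * sqrt pi * (S / sqrt (real m)) * nuclear_norm D n X)"
    using \<open>m > 0\<close> by (simp add: r_def real_sqrt_divide field_simps)
  finally have "expectation ?h \<le> 4 * sqrt pi * (S / sqrt (real m)) * nuclear_norm D n X"
    by (rule mult_left_le_imp_le) (use \<open>m > 0\<close> in simp)
  then show ?thesis
    using int unfolding h_def S_def by blast
qed

end
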